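(* Let $G$ be a graph and $uv$ an edge of $G$. For each connected component $R_k$ ($k=1,\dots,K$) of the subgraph induced by $R$, consider the following two linear programmes. (0) Maximise $(\mathbf{c}_k^0)^T\mathbf{x}^0$ over real vectors $\mathbf{x}^0$ indexed by $\triangle^k(u,v)\cup\square^k(u)\cup\square^k(v)$, where $\mathbf{c}_k^0=[m_u-m_v,\ m_u,\ -m_v]^T$ in the block order $[\triangle^k(u,v),\square^k(u),\square^k(v)]$, subject to the blockwise bounds $$[-1,\ 0,\ -1]\le(\mathbf{x}^0)^T\le[1,\ 1,\ 0]$$ and $-\mathbb{1}\le M_k^0\mathbf{x}^0\le\mathbb{1}$, where $M_k^0$ is the incidence matrix of the symmetric digraph associated to the subgraph of $G$ induced by $\triangle^k(u,v)\cup\square^k(u)\cup\square^k(v)$. ($-$) Maximise $(\mathbf{c}_k^-)^T\mathbf{x}^-$ over real vectors $\mathbf{x}^-$ indexed by $R_k$, where $\mathbf{c}_k^-=[m_u-m_v,\ m_u,\ m_u,\ -m_v,\ -m_v]^T$ in the block order $[\triangle^k(u,v),\square^k(u),\mathrm{Pent}^k(u),\square^k(v),\mathrm{Pent}^k(v)]$ (and with cost coefficient $0$ on $R_k\cap\mathrm{Pent}(u,v)$), subject to the blockwise bounds, in the same block order, $$[-1,\ -1,\ 0,\ -2,\ -2]\le(\mathbf{x}^-)^T\le[0,\ 1,\ 1,\ 0,\ -1]$$ (no bounds being imposed on the coordinates in $R_k\cap\mathrm{Pent}(u,v)$) and $-\mathbb{1}\le M_k^-\mathbf{x}^-\le\mathbb{1}$,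 where $M_k^-$ is the incidence matrix of the symmetric digraph associated to the subgraph of $G$ induced by $R_k$. Let $\mathbf{x}_k^0$ and $\mathbf{x}_k^-$ be optimal solutions of these two programmes. Then $$W(u,v)=\Big(1-\frac{\triangle_{uv}}{d_u\lor d_v}\Big)\lor\Big(\frac{n_u+\mathrm{Pent}_u}{d_u}+\frac{n_v+\mathrm{Pent}_v}{d_v}+\sum_{k}(\mathbf{c}_k^0)^T\mathbf{x}_k^0\Big)\lor\Big(\frac{n_u-1}{d_u}+\frac{2n_v}{d_v}+\sum_{k}(\mathbf{c}_k^-)^T\mathbf{x}_k^-\Big).$$
   Context: Graphs are simple, locally finite and unweighted; $\rho$ is the geodesic graph distance. $N(w)$ is the set of neighbours of $w$, $d_w=|N(w)|$, $m_w=1/d_w$; $\alpha\lor\beta=\max(\alpha,\beta)$. The Wasserstein distance is $$W(u,v)=\sup_{x}\Big(m_u\sum_{a\in N(u)}x(a)-m_v\sum_{b\in N(v)}x(b)\Big),$$ the supremum over all maps $x:G\to\mathbb{R}$ on vertices with $|x(a)-x(b)|\le\rho(a,b)$ for all $a,b$. Fix the edge $uv$ and let $(a,b)\in\{(u,v),(v,u)\}$. $\triangle(uv)=\triangle(u,v)=N(u)\cap N(v)$, $\triangle_{uv}=|\triangle(uv)|$. $\square(a)\subseteq N(a)\setminus\{b\}$ is the set of neighbours of $a$ (other than $b$) lying on a 4-cycle containing the edge $uv$ but on no 3-cycle containing $uv$. $\mathrm{Pent}(a)\subseteq N(a)\setminus\{b\}$ is the set of those lying on a 5-cycle containing the edge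 $uv$ but on no 3- or 4-cycle containing $uv$; $\mathrm{Pent}_a=|\mathrm{Pent}(a)|$. $\mathrm{Pent}(u,v)$ is the set of vertices at distance exactly 2 from both $u$ and $v$. $\mathrm{Fr}(a)=(N(a)\setminus\{b\})\setminus(\triangle(uv)\cup\square(a)\cup\mathrm{Pent}(a))$ and $n_a=|\mathrm{Fr}(a)|$. $R=\triangle(uv)\cup\square(u)\cup\square(v)\cup\mathrm{Pent}(u)\cup\mathrm{Pent}(v)\cup\mathrm{Pent}(u,v)$, and $R_1,\dots,R_K$ are the connected components of the subgraph of $G$ induced by $R$. $\triangle^k(u,v)=R_k\cap\triangle(u,v)$, $\square^k(a)=R_k\cap\square(a)$, $\mathrm{Pent}^k(a)=R_k\cap\mathrm{Pent}(a)$. The symmetric digraph associated to a graph $H$ has, for each edge $ab$ of $H$, the two directed edges $(a,b)$ and $(b,a)$. Its incidence matrix has rows indexed by directed edges $e$ and columns by vertices $w$, with entry $1$ if $e$ enters $w$, $-1$ if $e$ leaves $w$, $0$ otherwise. $\mathbb{1}$ is the all-ones vector; inequalities between vectors are coordinatewise. A "block" vector means that each listed number is the common value on all coordinates of the corresponding block. *)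

theory Defs
  imports Complex_Main "Graph_Theory.Graph_Theory"
begin

text \<open>
  As in \<^theory>\<open>Graph_Theory.Digraph\<close>, a simple graph is identified with its associated symmetric
  loop-free digraph: every edge \<open>ab\<close> is represented by the two arcs \<open>(a, b)\<close> and \<open>(b, a)\<close>.
\<close>

locale locally_finite_graph = pair_bidirected_digraph +
  assumes locally_finite: "w \<in> pverts G \<Longrightarrow> finite {z. (w, z) \<in> parcs G}"

definition nbh :: "'a pair_pre_digraph \<Rightarrow> 'a \<Rightarrow> 'a set" where
  "nbh G w = {z. (w, z) \<in> parcs G}"

definition deg :: "'a pair_pre_digraph \<Rightarrow> 'a \<Rightarrow> nat" where
  "deg G w = card (nbh G w)"

definition mass :: "'a pair_pre_digraph \<Rightarrow> 'a \<Rightarrow> real" where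
  "mass G w = 1 / real (deg G w)"

text \<open>The distance takes the value \<open>\<infinity>\<close> on vertices in different components.\<close>

definition geodist :: "'a pair_pre_digraph \<Rightarrow> 'a \<Rightarrow> 'a \<Rightarrow> ereal" where
  "geodist G a b = wf_digraph.\<mu> (with_proj G) (\<lambda>_. 1) a b"

definition lipschitz1 :: "'a pair_pre_digraph \<Rightarrow> ('a \<Rightarrow> real) \<Rightarrow> bool" where
  "lipschitz1 G x \<longleftrightarrow>
     (\<forall>a\<in>pverts G. \<forall>b\<in>pverts G. ereal \<bar>x a - x b\<bar> \<le> geodist G a b)"

text \<open>
  For adjacent \<open>u\<close> and \<open>v\<close> the supremum is over a nonempty set of reals that is bounded above,
  since both averages are taken within distance 1 of \<open>u\<close> and \<open>v\<close>, respectively.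
\<close>

definition wasserstein :: "'a pair_pre_digraph \<Rightarrow> 'a \<Rightarrow> 'a \<Rightarrow> real" where
  "wasserstein G u v =
     (SUP x\<in>{x. lipschitz1 G x}.
        mass G u * (\<Sum>a\<in>nbh G u. x a) - mass G v * (\<Sum>b\<in>nbh G v. x b))"


text \<open>
  The library's directed cycles include \<open>a, b, a\<close>, but those of length at least 3 are exactly
  the cycles of the underlying simple graph with a chosen starting point and orientation.
  The vertices of a closed walk are the tails of its arcs.
\<close>

definition on_cycle_with_edge :: "'a pair_pre_digraph \<Rightarrow> nat \<Rightarrow> 'a \<Rightarrow> 'a \<Rightarrow> 'a \<Rightarrow> bool" where
  "on_cycle_with_edge G k u v w \<longleftrightarrow>
     (\<exists>p. pre_digraph.cycle (with_proj G) p \<and> length p = k \<and>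
          ((u, v) \<in> set p \<or> (v, u) \<in> set p) \<and> w \<in> fst ` set p)"

definition triangles :: "'a pair_pre_digraph \<Rightarrow> 'a \<Rightarrow> 'a \<Rightarrow> 'a set" where
  "triangles G u v = nbh G u \<inter> nbh G v"

text \<open>
  In \<open>square G a b\<close>, \<open>pent G a b\<close> and \<open>free G a b\<close> the first vertex is the one
  whose neighbours are selected; the edge under consideration is \<open>ab\<close>.
\<close>

definition square :: "'a pair_pre_digraph \<Rightarrow> 'a \<Rightarrow> 'a \<Rightarrow> 'a set" where
  "square G a b = {w \<in> nbh G a - {b}.
     on_cycle_with_edge G 4 a b w \<and> \<not> on_cycle_with_edge G 3 a b w}"

definition pent :: "'a pair_pre_digraph \<Rightarrow> 'a \<Rightarrow> 'a \<Rightarrow> 'a set" where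
  "pent G a b = {w \<in> nbh G a - {b}.
     on_cycle_with_edge G 5 a b w \<and>
     \<not> on_cycle_with_edge G 3 a b w \<and> \<not> on_cycle_with_edge G 4 a b w}"

definition pent_mid :: "'a pair_pre_digraph \<Rightarrow> 'a \<Rightarrow> 'a \<Rightarrow> 'a set" where
  "pent_mid G u v = {w \<in> pverts G. geodist G u w = 2 \<and> geodist G v w = 2}"

definition free :: "'a pair_pre_digraph \<Rightarrow> 'a \<Rightarrow> 'a \<Rightarrow> 'a set" where
  "free G a b = (nbh G a - {b}) - (triangles G a b \<union> square G a b \<union> pent G a b)"

definition core :: "'a pair_pre_digraph \<Rightarrow> 'a \<Rightarrow> 'a \<Rightarrow> 'a set" where
  "core G u v = triangles G u v \<union> square G u v \<union> square G v u
     \<union> pent G u v \<union> pent G v u \<union> pent_mid G u v"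

text \<open>Strongly connected components of a symmetric digraph are its connected components.\<close>

definition core_components :: "'a pair_pre_digraph \<Rightarrow> 'a \<Rightarrow> 'a \<Rightarrow> 'a set set" where
  "core_components G u v = pre_digraph.sccs_verts (with_proj G \<restriction> core G u v)"


text \<open>
  A vector indexed by a finite vertex set \<open>S\<close> is a function on vertices of which only the values
  on \<open>S\<close> are used.
\<close>

definition incidence :: "'a \<times> 'a \<Rightarrow> 'a \<Rightarrow> real" where
  "incidence e w = (if w = snd e then 1 else if w = fst e then -1 else 0)"

definition incidence_bounded :: "'a pair_pre_digraph \<Rightarrow> 'a set \<Rightarrow> ('a \<Rightarrow> real) \<Rightarrow> bool" where
  "incidence_bounded G S x \<longleftrightarrow>
     (\<forall>e\<in>arcs (with_proj G \<restriction> S).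
        -1 \<le> (\<Sum>w\<in>S. incidence e w * x w) \<and> (\<Sum>w\<in>S. incidence e w * x w) \<le> 1)"

definition bounded_on :: "'a set \<Rightarrow> real \<Rightarrow> real \<Rightarrow> ('a \<Rightarrow> real) \<Rightarrow> bool" where
  "bounded_on S l h x \<longleftrightarrow> (\<forall>w\<in>S. l \<le> x w \<and> x w \<le> h)"

definition index0 :: "'a pair_pre_digraph \<Rightarrow> 'a \<Rightarrow> 'a \<Rightarrow> 'a set \<Rightarrow> 'a set" where
  "index0 G u v R = (R \<inter> triangles G u v) \<union> (R \<inter> square G u v) \<union> (R \<inter> square G v u)"

definition cost0 :: "'a pair_pre_digraph \<Rightarrow> 'a \<Rightarrow> 'a \<Rightarrow> 'a \<Rightarrow> real" where
  "cost0 G u v w =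
     (if w \<in> triangles G u v then mass G u - mass G v
      else if w \<in> square G u v then mass G u
      else if w \<in> square G v u then - mass G v
      else 0)"

definition feasible0 ::
    "'a pair_pre_digraph \<Rightarrow> 'a \<Rightarrow> 'a \<Rightarrow> 'a set \<Rightarrow> ('a \<Rightarrow> real) \<Rightarrow> bool" where
  "feasible0 G u v R x \<longleftrightarrow>
     bounded_on (R \<inter> triangles G u v) (-1) 1 x \<and>
     bounded_on (R \<inter> square G u v) 0 1 x \<and>
     bounded_on (R \<inter> square G v u) (-1) 0 x \<and>
     incidence_bounded G (index0 G u v R) x"

definition objective0 ::
    "'a pair_pre_digraph \<Rightarrow> 'a \<Rightarrow> 'a \<Rightarrow> 'a set \<Rightarrow> ('a \<Rightarrow> real) \<Rightarrow> real" where
  "objective0 G u v R x = (\<Sum>w\<in>index0 G u v R. cost0 G u v w * x w)"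

definition optimal0 ::
    "'a pair_pre_digraph \<Rightarrow> 'a \<Rightarrow> 'a \<Rightarrow> 'a set \<Rightarrow> ('a \<Rightarrow> real) \<Rightarrow> bool" where
  "optimal0 G u v R x \<longleftrightarrow> is_arg_max (objective0 G u v R) (feasible0 G u v R) x"

definition cost_minus :: "'a pair_pre_digraph \<Rightarrow> 'a \<Rightarrow> 'a \<Rightarrow> 'a \<Rightarrow> real" where
  "cost_minus G u v w =
     (if w \<in> triangles G u v then mass G u - mass G v
      else if w \<in> square G u v then mass G u
      else if w \<in> pent G u v then mass G u
      else if w \<in> square G v u then - mass G v
      else if w \<in> pent G v u then - mass G v
      else 0)"

definition feasible_minus ::
    "'a pair_pre_digraph \<Rightarrow> 'a \<Rightarrow> 'a \<Rightarrow> 'a set \<Rightarrow> ('a \<Rightarrow> real) \<Rightarrow> bool" where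
  "feasible_minus G u v R x \<longleftrightarrow>
     bounded_on (R \<inter> triangles G u v) (-1) 0 x \<and>
     bounded_on (R \<inter> square G u v) (-1) 1 x \<and>
     bounded_on (R \<inter> pent G u v) 0 1 x \<and>
     bounded_on (R \<inter> square G v u) (-2) 0 x \<and>
     bounded_on (R \<inter> pent G v u) (-2) (-1) x \<and>
     incidence_bounded G R x"

definition objective_minus ::
    "'a pair_pre_digraph \<Rightarrow> 'a \<Rightarrow> 'a \<Rightarrow> 'a set \<Rightarrow> ('a \<Rightarrow> real) \<Rightarrow> real" where
  "objective_minus G u v R x = (\<Sum>w\<in>R. cost_minus G u v w * x w)"

definition optimal_minus ::
    "'a pair_pre_digraph \<Rightarrow> 'a \<Rightarrow> 'a \<Rightarrow> 'a set \<Rightarrow> ('a \<Rightarrow> real) \<Rightarrow> bool" where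
  "optimal_minus G u v R x \<longleftrightarrow> is_arg_max (objective_minus G u v R) (feasible_minus G u v R) x"

end

theory Submission
  imports Defs
begin

text \<open>
  Normalise a potential by \<open>x u = 0\<close>. Since distances are integers, the random rounding
  \<open>\<lfloor>x + \<theta>\<rfloor>\<close> of a 1-Lipschitz potential is again 1-Lipschitz, and it
  averages to \<open>x\<close>; hence the supremum may be taken over integer-valued potentials, for which
  \<open>x v\<close> is 1, 0 or -1. These three cases give the three terms of the maximum. In the last two,
  the free neighbours of \<open>u\<close> and \<open>v\<close> take their extreme values, and the restriction of
  \<open>x\<close> to the remaining vertices, after clipping, is feasible for the linear programme.
  Conversely, a feasible vector violates the Lipschitz condition for no pair of neighbours of
  \<open>u\<close> or \<open>v\<close>: only pairs at distance at most 2 matter, and a midpoint of a relevant pair lies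
  in \<open>core G u v\<close>.
\<close>

text \<open>Hermite's identity. If the floor of n t is q n + r with 0 <= r < n, then the shift by
  k/n lifts the floor of t from q to q + 1 exactly for the r indices k >= n - r. It makes the
  average of the rounded potentials explicit.\<close>

lemma sum_floor_shifts:
  fixes t :: real and n :: nat
  assumes "0 < n"
  shows "(\<Sum>k<n. \<lfloor>t + real k / real n\<rfloor>) = \<lfloor>real n * t\<rfloor>"
proof -
  define m where "m = \<lfloor>real n * t\<rfloor>"
  define q r where "q = m div int n" and "r = nat (m mod int n)"
  have m: "m = q * int n + int r" and r: "r < n"
    using assms pos_mod_bound[of "int n" m] by (auto simp: q_def r_def nat_less_iff)
  have "\<lfloor>t + real k / real n\<rfloor> = q + (if n - r \<le> k then 1 else 0)" if "k < n" for k
  proof -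
    have "real_of_int m \<le> real n * t" "real n * t < real_of_int m + 1"
      unfolding m_def by linarith+
    then have t: "real_of_int q * n + r \<le> n * t" "n * t < real_of_int q * n + r + 1"
      unfolding m by simp_all
    have "\<lfloor>t + real k / real n\<rfloor> = \<lfloor>real n * (t + real k / real n) / real n\<rfloor>"
      using assms by simp
    also have "real n * (t + real k / real n) = real n * t + real k"
      using assms by (simp add: field_simps)
    also have "\<lfloor>(real n * t + real k) / real n\<rfloor> = q + (if n - r \<le> k then 1 else 0)"
    proof (cases "n - r \<le> k")
      case True
      then have "real n \<le> real r + real k" "real k + real r + 1 \<le> 2 * real n"
        using that r by linarith+
      with t True assms show ?thesis
        by (intro floor_unique) (auto simp: field_simps)
    next
      case False
      then have "real k + real r + 1 \<le> real n" by linarith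
      with t False assms show ?thesis
        by (intro floor_unique) (auto simp: field_simps)
    qed
    finally show ?thesis .
  qed
  then have "(\<Sum>k<n. \<lfloor>t + real k / real n\<rfloor>) = (\<Sum>k<n. q + (if n - r \<le> k then 1 else 0))"
    by (intro sum.cong) auto
  also have "\<dots> = q * int n + int (card {k \<in> {..<n}. n - r \<le> k})"
    by (simp add: sum.distrib flip: sum.inter_filter)
  also have "{k \<in> {..<n}. n - r \<le> k} = {n - r..<n}" by auto
  finally show ?thesis using m r by (simp add: m_def)
qed

section \<open>Walks, distances and Lipschitz potentials\<close>

context locally_finite_graph
begin

lemma adj_sym: "(x, y) \<in> parcs G \<Longrightarrow> (y, x) \<in> parcs G"
  using pair_sym_arcs by (auto simp: symmetric_def sym_def)

lemma adj_irrefl: "(x, x) \<notin> parcs G"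
  using pair_no_loops by fastforce

lemma finite_nbh: "finite (nbh G w)"
proof (cases "w \<in> pverts G")
  case True
  then show ?thesis unfolding nbh_def by (rule locally_finite)
next
  case False
  then have "nbh G w = {}"
    by (auto simp: nbh_def dest: in_arcsD1)
  then show ?thesis by simp
qed

lemma awalk_imp_relpow: "awalk a p b \<Longrightarrow> (a, b) \<in> parcs G ^^ length p"
  by (induction p arbitrary: a) (auto simp: awalk_Nil_iff awalk_Cons_iff simp del: relpow.simps intro: relpow_0_I relpow_Suc_I2)

text \<open>Together with \<open>awalk_imp_relpow\<close> this trades walks for relation powers,
  where the length is explicit. The hypothesis on \<open>a\<close> matters for length 0: an empty
  walk must sit at a vertex.\<close>

lemma relpow_imp_awalk:
  assumes "(a, b) \<in> parcs G ^^ n" "a \<in> pverts G"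
  shows "\<exists>p. awalk a p b \<and> length p = n"
  using assms
proof (induction n arbitrary: a)
  case 0
  then show ?case by (auto simp: awalk_Nil_iff)
next
  case (Suc n)
  then obtain c where c: "(a, c) \<in> parcs G" "(c, b) \<in> parcs G ^^ n"
    by (metis relpow_Suc_E2)
  with Suc.IH obtain p where "awalk c p b" "length p = n"
    by (meson in_arcsD2)
  with c have "awalk a ((a, c) # p) b \<and> length ((a, c) # p) = Suc n"
    by (auto simp: awalk_Cons_iff dest: in_arcsD1)
  then show ?case by blast
qed

lemma awalk_cost_one: "awalk_cost (\<lambda>_. 1) p = real (length p)"
  by (induction p) auto

lemma geodist_le:
  assumes "(a, b) \<in> parcs G ^^ n" "a \<in> pverts G"
  shows "geodist G a b \<le> ereal (real n)"
proof -
  obtain p where "awalk a p b" "length p = n"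
    using relpow_imp_awalk[OF assms] by blast
  then show ?thesis
    using min_cost_le_walk_cost[of a p b "\<lambda>_. 1"] unfolding geodist_def
    by (simp add: awalk_cost_one)
qed

text \<open>The distance is an infimum over walks. If there is no walk, the hypothesis is vacuous
  and the distance is infinite, so disconnected pairs need no separate treatment.\<close>

lemma geodist_ge:
  assumes "\<And>n. (a, b) \<in> parcs G ^^ n \<Longrightarrow> r \<le> real n"
  shows "ereal r \<le> geodist G a b"
  unfolding geodist_def \<mu>_def
  by (rule INF_greatest) (auto simp: awalk_cost_one intro!: assms dest: awalk_imp_relpow)

lemma geodist_eq_2_iff:
  assumes "a \<in> pverts G"
  shows "geodist G a b = 2 \<longleftrightarrow>
    a \<noteq> b \<and> (a, b) \<notin> parcs G \<and> (\<exists>c. (a, c) \<in> parcs G \<and> (c, b) \<in> parcs G)"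
proof
  assume two: "geodist G a b = 2"
  have no: "(a, b) \<notin> parcs G ^^ n" if "n < 2" for n
  proof
    assume "(a, b) \<in> parcs G ^^ n"
    from geodist_le[OF this assms] two that show False by auto
  qed
  from no[of 0] no[of 1] have "a \<noteq> b" "(a, b) \<notin> parcs G" by auto
  moreover have "(a, b) \<in> parcs G ^^ 2"
  proof (rule ccontr)
    assume "(a, b) \<notin> parcs G ^^ 2"
    with no have "3 \<le> n" if "(a, b) \<in> parcs G ^^ n" for n
      using that by (cases "n < 2"; cases "n = 2") auto
    then have "ereal 3 \<le> geodist G a b"
      by (intro geodist_ge) force
    with two show False by simp
  qed
  then have "\<exists>c. (a, c) \<in> parcs G \<and> (c, b) \<in> parcs G"
    by (auto simp: numeral_2_eq_2)
  ultimately show "a \<noteq> b \<and> (a, b) \<notin> parcs G \<and> (\<exists>c. (a, c) \<in> parcs G \<and> (c, b) \<in> parcs G)"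
    by blast
next
  assume r: "a \<noteq> b \<and> (a, b) \<notin> parcs G \<and> (\<exists>c. (a, c) \<in> parcs G \<and> (c, b) \<in> parcs G)"
  then have "(a, b) \<in> parcs G ^^ 2" by (auto simp: numeral_2_eq_2)
  from geodist_le[OF this assms] have "geodist G a b \<le> 2" by simp
  moreover have "2 \<le> n" if "(a, b) \<in> parcs G ^^ n" for n
  proof (rule ccontr)
    assume "\<not> 2 \<le> n"
    then have "n = 0 \<or> n = 1" by linarith
    with that r show False by auto
  qed
  then have "ereal 2 \<le> geodist G a b"
    by (intro geodist_ge) force
  ultimately show "geodist G a b = 2" by (simp add: antisym)
qed

lemma abs_diff_le_relpow:
  fixes x :: "'a \<Rightarrow> real"
  assumes "\<And>a b. (a, b) \<in> parcs G \<Longrightarrow> \<bar>x a - x b\<bar> \<le> 1" "(a, b) \<in> parcs G ^^ n"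
  shows "\<bar>x a - x b\<bar> \<le> real n"
  using assms(2)
proof (induction n arbitrary: b)
  case (Suc n)
  then obtain c where "(a, c) \<in> parcs G ^^ n" "(c, b) \<in> parcs G" by auto
  with Suc.IH[of c] assms(1)[of c b] show ?case by simp
qed simp

text \<open>The metric condition is local: steps of at most 1 along arcs add up to at most n along a
  walk of length n.\<close>

lemma lipschitz1_iff:
  "lipschitz1 G x \<longleftrightarrow> (\<forall>a b. (a, b) \<in> parcs G \<longrightarrow> \<bar>x a - x b\<bar> \<le> 1)"
proof
  assume L: "lipschitz1 G x"
  show "\<forall>a b. (a, b) \<in> parcs G \<longrightarrow> \<bar>x a - x b\<bar> \<le> 1"
  proof (intro allI impI)
    fix a b assume ab: "(a, b) \<in> parcs G"
    then have "a \<in> pverts G" "b \<in> pverts G" by (auto dest: in_arcsD1 in_arcsD2)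
    with L have "ereal \<bar>x a - x b\<bar> \<le> geodist G a b" by (auto simp: lipschitz1_def)
    also have "\<dots> \<le> ereal (real 1)"
      using ab \<open>a \<in> pverts G\<close> by (intro geodist_le) auto
    finally show "\<bar>x a - x b\<bar> \<le> 1" by simp
  qed
next
  assume "\<forall>a b. (a, b) \<in> parcs G \<longrightarrow> \<bar>x a - x b\<bar> \<le> 1"
  then show "lipschitz1 G x"
    unfolding lipschitz1_def by (auto intro!: geodist_ge abs_diff_le_relpow)
qed

text \<open>Infimal convolution of \<open>x\<close> with the distance; an a priori bound on the range reduces
  the Lipschitz condition on \<open>S\<close> to pairs at distance at most 2.\<close>

lemma lipschitz1_extension:
  fixes x :: "'a \<Rightarrow> real"
  assumes range: "\<And>s. s \<in> S \<Longrightarrow> l \<le> x s \<and> x s \<le> l + 3"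
    and adj: "\<And>s t. s \<in> S \<Longrightarrow> t \<in> S \<Longrightarrow> (s, t) \<in> parcs G \<Longrightarrow> x t - x s \<le> 1"
    and dist2: "\<And>s t c. s \<in> S \<Longrightarrow> t \<in> S \<Longrightarrow> (s, c) \<in> parcs G \<Longrightarrow> (c, t) \<in> parcs G
      \<Longrightarrow> x t - x s \<le> 2"
  shows "\<exists>y. lipschitz1 G y \<and> (\<forall>s\<in>S. y s = x s)"
proof -
  \<comment> \<open>The cap \<open>l + 3\<close> keeps the infimum meaningful at vertices that no
    element of \<open>S\<close> reaches. Since no value on \<open>S\<close> exceeds the cap, it does
    not lower \<open>y\<close> there.\<close>
  define A where "A z = insert (l + 3) {x s + real n | s n. s \<in> S \<and> (s, z) \<in> parcs G ^^ n}" for z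
  define y where "y z = Inf (A z)" for z
  have lower: "l \<le> r" if "r \<in> A z" for r z
    using that range unfolding A_def by force
  then have bdd: "bdd_below (A z)" for z unfolding bdd_below_def by blast
  have ne: "A z \<noteq> {}" for z unfolding A_def by blast
  have step: "y z' \<le> y z + 1" if zz: "(z, z') \<in> parcs G" for z z'
  proof -
    have "y z' - 1 \<le> r" if "r \<in> A z" for r
    proof (cases "r = l + 3")
      case True
      have "y z' \<le> l + 3" unfolding y_def by (rule cInf_lower[OF _ bdd]) (simp add: A_def)
      with True show ?thesis by simp
    next
      case False
      with that obtain s n where sn: "r = x s + real n" "s \<in> S" "(s, z) \<in> parcs G ^^ n"
        unfolding A_def by blast
      with zz have "(s, z') \<in> parcs G ^^ Suc n" by auto
      with sn have "r + 1 \<in> A z'" unfolding A_def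
        by (intro insertI2 CollectI exI[of _ s] exI[of _ "Suc n"]) auto
      then have "y z' \<le> r + 1" unfolding y_def by (rule cInf_lower) (rule bdd)
      then show ?thesis by simp
    qed
    then have "y z' - 1 \<le> y z" unfolding y_def[of z] by (intro cInf_greatest ne)
    then show ?thesis by simp
  qed
  have "\<bar>y a - y b\<bar> \<le> 1" if "(a, b) \<in> parcs G" for a b
    using step[OF that] step[OF adj_sym[OF that]] by linarith
  then have "lipschitz1 G y" by (simp add: lipschitz1_iff)
  moreover have "y s = x s" if s: "s \<in> S" for s
  proof (rule antisym)
    have "x s \<in> A s" unfolding A_def
      using s by (intro insertI2 CollectI exI[of _ s] exI[of _ 0]) auto
    then show "y s \<le> x s" unfolding y_def by (rule cInf_lower) (rule bdd)
    have "x s \<le> r" if "r \<in> A s" for r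
    proof (cases "r = l + 3")
      case True
      with range[OF s] show ?thesis by simp
    next
      case False
      with that obtain t n where tn: "r = x t + real n" "t \<in> S" "(t, s) \<in> parcs G ^^ n"
        unfolding A_def by blast
      consider "n = 0" | "n = 1" | "n = 2" | "n \<ge> 3" by linarith
      then show ?thesis
      proof cases
        case 1 with tn show ?thesis by simp
      next
        case 2 with tn adj[of t s] s show ?thesis by auto
      next
        case 3
        with tn obtain c where "(t, c) \<in> parcs G" "(c, s) \<in> parcs G"
          by (auto simp: numeral_2_eq_2)
        with 3 tn dist2[of t s c] s show ?thesis by auto
      next
        \<comment> \<open>Values on \<open>S\<close> differ by at most 3, so three or more steps
          impose nothing new.\<close>
        case 4 with tn range[OF s] range[of t] show ?thesis by auto
      qed
    qed
    then show "x s \<le> y s" unfolding y_def by (intro cInf_greatest ne)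
  qed
  ultimately show ?thesis by blast
qed

section \<open>Short cycles and the blocks in terms of adjacency\<close>

lemma cycle_3_iff:
  "cycle p \<and> length p = 3 \<longleftrightarrow> (\<exists>x y z. distinct [x, y, z] \<and> p = [(x, y), (y, z), (z, x)] \<and>
     set p \<subseteq> parcs G)"
  by (auto simp: cycle_def awalk_Cons_iff awalk_Nil_iff length_Suc_conv numeral_eq_Suc
     dest: in_arcsD1 in_arcsD2)

lemma cycle_4_iff:
  "cycle p \<and> length p = 4 \<longleftrightarrow> (\<exists>x y z w. distinct [x, y, z, w] \<and>
     p = [(x, y), (y, z), (z, w), (w, x)] \<and> set p \<subseteq> parcs G)"
  by (auto simp: cycle_def awalk_Cons_iff awalk_Nil_iff length_Suc_conv numeral_eq_Suc
     dest: in_arcsD1 in_arcsD2)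

lemma cycle_5_iff:
  "cycle p \<and> length p = 5 \<longleftrightarrow> (\<exists>x y z w t. distinct [x, y, z, w, t] \<and>
     p = [(x, y), (y, z), (z, w), (w, t), (t, x)] \<and> set p \<subseteq> parcs G)"
  by (auto simp: cycle_def awalk_Cons_iff awalk_Nil_iff length_Suc_conv numeral_eq_Suc
     dest: in_arcsD1 in_arcsD2)

lemma on_cycle_3_iff:
  assumes "(a, b) \<in> parcs G" "(a, w) \<in> parcs G" "w \<noteq> b"
  shows "on_cycle_with_edge G 3 a b w \<longleftrightarrow> (b, w) \<in> parcs G"
proof
  assume "on_cycle_with_edge G 3 a b w"
  then obtain x y z where "set [(x, y), (y, z), (z, x)] \<subseteq> parcs G"
    "(a, b) \<in> set [(x, y), (y, z), (z, x)] \<or> (b, a) \<in> set [(x, y), (y, z), (z, x)]"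
    "w \<in> fst ` set [(x, y), (y, z), (z, x)]"
    unfolding on_cycle_with_edge_def using cycle_3_iff by metis
  then show "(b, w) \<in> parcs G"
    using assms adj_irrefl by (auto intro: adj_sym)
next
  assume "(b, w) \<in> parcs G"
  with assms have "cycle [(a, b), (b, w), (w, a)]"
    using cycle_3_iff[of "[(a, b), (b, w), (w, a)]"] adj_irrefl by (auto intro: adj_sym)
  then show "on_cycle_with_edge G 3 a b w"
    unfolding on_cycle_with_edge_def by (intro exI[of _ "[(a, b), (b, w), (w, a)]"]) auto
qed

text \<open>Of the two vertices opposite the edge on a 4-cycle, one is adjacent to \<open>b\<close>.
  As \<open>w\<close> is not, it must be the one next to \<open>a\<close>, so the cycle reads a, b,
  c, w.\<close>

lemma on_cycle_4_iff:
  assumes "(a, b) \<in> parcs G" "(a, w) \<in> parcs G" "w \<noteq> b" "(b, w) \<notin> parcs G"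
  shows "on_cycle_with_edge G 4 a b w \<longleftrightarrow>
    (\<exists>c. (b, c) \<in> parcs G \<and> c \<noteq> a \<and> (c, w) \<in> parcs G)"
proof
  assume "on_cycle_with_edge G 4 a b w"
  then obtain x y z t where "set [(x, y), (y, z), (z, t), (t, x)] \<subseteq> parcs G"
    "distinct [x, y, z, t]"
    "(a, b) \<in> set [(x, y), (y, z), (z, t), (t, x)] \<or> (b, a) \<in> set [(x, y), (y, z), (z, t), (t, x)]"
    "w \<in> fst ` set [(x, y), (y, z), (z, t), (t, x)]"
    unfolding on_cycle_with_edge_def using cycle_4_iff by metis
  then show "\<exists>c. (b, c) \<in> parcs G \<and> c \<noteq> a \<and> (c, w) \<in> parcs G"
    using assms adj_irrefl by (auto dest: adj_sym)
next
  assume "\<exists>c. (b, c) \<in> parcs G \<and> c \<noteq> a \<and> (c, w) \<in> parcs G"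
  then obtain c where "(b, c) \<in> parcs G" "c \<noteq> a" "(c, w) \<in> parcs G" by blast
  with assms have "cycle [(a, b), (b, c), (c, w), (w, a)]"
    using cycle_4_iff[of "[(a, b), (b, c), (c, w), (w, a)]"] adj_irrefl by (auto intro: adj_sym)
  then show "on_cycle_with_edge G 4 a b w"
    unfolding on_cycle_with_edge_def by (intro exI[of _ "[(a, b), (b, c), (c, w), (w, a)]"]) auto
qed

text \<open>On a 5-cycle a, b, c, d, e the vertex \<open>w\<close> cannot be c, being non-adjacent
  to \<open>b\<close>, nor d, since then c would give the excluded 4-cycle. So \<open>w\<close> is
  the neighbour e of \<open>a\<close>. Conversely, non-adjacency of \<open>b\<close> and
  \<open>w\<close> keeps c distinct from \<open>w\<close>.\<close>

lemma on_cycle_5_iff: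
  assumes "(a, b) \<in> parcs G" "(a, w) \<in> parcs G" "w \<noteq> b" "(b, w) \<notin> parcs G"
    "\<not> (\<exists>c. (b, c) \<in> parcs G \<and> c \<noteq> a \<and> (c, w) \<in> parcs G)"
  shows "on_cycle_with_edge G 5 a b w \<longleftrightarrow>
    (\<exists>c d. (b, c) \<in> parcs G \<and> c \<noteq> a \<and> (c, d) \<in> parcs G \<and> d \<noteq> a \<and> d \<noteq> b \<and> (d, w) \<in> parcs G)"
proof
  assume "on_cycle_with_edge G 5 a b w"
  then obtain x y z t s where "set [(x, y), (y, z), (z, t), (t, s), (s, x)] \<subseteq> parcs G"
    "distinct [x, y, z, t, s]"
    "(a, b) \<in> set [(x, y), (y, z), (z, t), (t, s), (s, x)] \<or>
     (b, a) \<in> set [(x, y), (y, z), (z, t), (t, s), (s, x)]"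
    "w \<in> fst ` set [(x, y), (y, z), (z, t), (t, s), (s, x)]"
    unfolding on_cycle_with_edge_def using cycle_5_iff by metis
  then show "\<exists>c d. (b, c) \<in> parcs G \<and> c \<noteq> a \<and> (c, d) \<in> parcs G \<and> d \<noteq> a \<and> d \<noteq> b \<and> (d, w) \<in> parcs G"
    using assms adj_irrefl by (auto dest: adj_sym) (metis adj_sym)+
next
  assume "\<exists>c d. (b, c) \<in> parcs G \<and> c \<noteq> a \<and> (c, d) \<in> parcs G \<and> d \<noteq> a \<and> d \<noteq> b \<and> (d, w) \<in> parcs G"
  then obtain c d where cd: "(b, c) \<in> parcs G" "c \<noteq> a" "(c, d) \<in> parcs G" "d \<noteq> a" "d \<noteq> b"
    "(d, w) \<in> parcs G" by blast
  let ?p = "[(a, b), (b, c), (c, d), (d, w), (w, a)]"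
  from cd assms have "cycle ?p"
    using cycle_5_iff[of ?p] adj_irrefl by (auto intro: adj_sym)
  then show "on_cycle_with_edge G 5 a b w"
    unfolding on_cycle_with_edge_def by (intro exI[of _ ?p]) auto
qed

lemma square_iff:
  assumes "(a, b) \<in> parcs G"
  shows "w \<in> square G a b \<longleftrightarrow> (a, w) \<in> parcs G \<and> w \<noteq> b \<and> (b, w) \<notin> parcs G \<and>
    (\<exists>c. (b, c) \<in> parcs G \<and> c \<noteq> a \<and> (c, w) \<in> parcs G)"
  using on_cycle_3_iff[OF assms, of w] on_cycle_4_iff[OF assms, of w]
  by (auto simp: square_def nbh_def)

lemma pent_iff:
  assumes "(a, b) \<in> parcs G"
  shows "w \<in> pent G a b \<longleftrightarrow> (a, w) \<in> parcs G \<and> w \<noteq> b \<and> (b, w) \<notin> parcs G \<and>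
    (\<nexists>c. (b, c) \<in> parcs G \<and> c \<noteq> a \<and> (c, w) \<in> parcs G) \<and>
    (\<exists>c d. (b, c) \<in> parcs G \<and> c \<noteq> a \<and> (c, d) \<in> parcs G \<and> d \<noteq> a \<and> d \<noteq> b \<and> (d, w) \<in> parcs G)"
  using on_cycle_3_iff[OF assms, of w] on_cycle_4_iff[OF assms, of w] on_cycle_5_iff[OF assms, of w]
  by (auto simp: pent_def nbh_def)

lemma pent_mid_iff:
  assumes "(a, b) \<in> parcs G"
  shows "w \<in> pent_mid G a b \<longleftrightarrow>
    w \<noteq> a \<and> w \<noteq> b \<and> (a, w) \<notin> parcs G \<and> (b, w) \<notin> parcs G \<and>
    (\<exists>c. (a, c) \<in> parcs G \<and> (c, w) \<in> parcs G) \<and> (\<exists>c. (b, c) \<in> parcs G \<and> (c, w) \<in> parcs G)"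
  using geodist_eq_2_iff[of a w] geodist_eq_2_iff[of b w] in_arcsD1[OF assms] in_arcsD2[OF assms]
  by (auto simp: pent_mid_def dest: in_arcsD2)

lemma triangles_iff: "w \<in> triangles G a b \<longleftrightarrow> (a, w) \<in> parcs G \<and> (b, w) \<in> parcs G"
  by (auto simp: triangles_def nbh_def)

lemma free_iff:
  assumes "(a, b) \<in> parcs G"
  shows "w \<in> free G a b \<longleftrightarrow> (a, w) \<in> parcs G \<and> w \<noteq> b \<and> (b, w) \<notin> parcs G \<and>
    (\<nexists>c. (b, c) \<in> parcs G \<and> c \<noteq> a \<and> (c, w) \<in> parcs G) \<and>
    (\<nexists>c d. (b, c) \<in> parcs G \<and> c \<noteq> a \<and> (c, d) \<in> parcs G \<and> d \<noteq> a \<and> d \<noteq> b \<and> (d, w) \<in> parcs G)"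
  by (auto simp: free_def nbh_def triangles_iff square_iff[OF assms] pent_iff[OF assms])

lemma finite_blocks:
  "finite (triangles G a b)" "finite (square G a b)" "finite (pent G a b)" "finite (free G a b)"
  by (auto intro: finite_subset[OF _ finite_nbh[of a]]
      simp: triangles_def square_def pent_def free_def)

lemma finite_pent_mid:
  assumes "(a, b) \<in> parcs G"
  shows "finite (pent_mid G a b)"
proof (rule finite_subset)
  show "pent_mid G a b \<subseteq> (\<Union>c\<in>nbh G a. nbh G c)"
    by (auto simp: pent_mid_iff[OF assms] nbh_def)
qed (simp add: finite_nbh)

lemma sum_nbh:
  fixes x :: "'a \<Rightarrow> real"
  assumes "(a, b) \<in> parcs G"
  shows "sum x (nbh G a) = x b + sum x (triangles G a b) + sum x (square G a b)
    + sum x (pent G a b) + sum x (free G a b)"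
proof -
  have "nbh G a = insert b (triangles G a b \<union> (square G a b \<union> (pent G a b \<union> free G a b)))"
    using assms by (auto simp: free_def nbh_def triangles_iff square_iff[OF assms] pent_iff[OF assms])
  moreover have "b \<notin> triangles G a b \<union> (square G a b \<union> (pent G a b \<union> free G a b))"
    by (auto simp: triangles_iff square_iff[OF assms] pent_iff[OF assms] free_iff[OF assms] adj_irrefl)
  moreover have "triangles G a b \<inter> (square G a b \<union> (pent G a b \<union> free G a b)) = {}"
    "square G a b \<inter> (pent G a b \<union> free G a b) = {}" "pent G a b \<inter> free G a b = {}"
    by (auto simp: triangles_iff square_iff[OF assms] pent_iff[OF assms] free_iff[OF assms])
  ultimately show ?thesis
    by (simp add: sum.union_disjoint finite_blocks)
qed

text \<open>Such an arc would close the 4-cycle a, b, c, w and put \<open>w\<close> into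
  \<open>square G a b\<close>.\<close>

lemma pent_free_not_adj:
  assumes "(a, b) \<in> parcs G" "w \<in> pent G a b \<union> free G a b" "(b, c) \<in> parcs G" "c \<noteq> a"
  shows "(w, c) \<notin> parcs G" "(c, w) \<notin> parcs G"
  using assms by (auto simp: pent_iff free_iff dest: adj_sym)

text \<open>If \<open>s\<close> lies on the 4-cycle a, b, c, s, an arc between \<open>s\<close> and
  \<open>w\<close> would close the 5-cycle a, b, c, s, w, and \<open>w\<close> would not be
  free.\<close>

lemma free_square_not_adj:
  assumes "(a, b) \<in> parcs G" "w \<in> free G a b" "s \<in> square G a b"
  shows "(w, s) \<notin> parcs G" "(s, w) \<notin> parcs G"
proof -
  show "(s, w) \<notin> parcs G"
    using assms adj_irrefl unfolding square_iff[OF assms(1)] free_iff[OF assms(1)] by blast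
  then show "(w, s) \<notin> parcs G" by (blast dest: adj_sym)
qed

lemma deg_pos: "(a, b) \<in> parcs G \<Longrightarrow> 0 < deg G a"
  unfolding deg_def using finite_nbh[of a] by (auto simp: card_gt_0_iff nbh_def)

text \<open>The row of an arc evaluates to head value minus tail value, because without loops the
  entries 1 and -1 stand in different columns. The matrix constraints are thus the Lipschitz
  condition on the arcs inside \<open>S\<close>.\<close>

lemma incidence_bounded_iff:
  assumes "finite S"
  shows "incidence_bounded G S x \<longleftrightarrow>
    (\<forall>a\<in>S. \<forall>b\<in>S. (a, b) \<in> parcs G \<longrightarrow> \<bar>x a - x b\<bar> \<le> 1)"
proof -
  have "(\<Sum>w\<in>S. incidence (a, b) w * x w) = x b - x a"
    if "a \<in> S" "b \<in> S" "(a, b) \<in> parcs G" for a b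
  proof -
    from that(3) have "a \<noteq> b" using adj_irrefl by auto
    then have "(\<Sum>w\<in>S. incidence (a, b) w * x w)
        = (\<Sum>w\<in>S. (if w = b then x w else 0) - (if w = a then x w else 0))"
      by (intro sum.cong) (auto simp: incidence_def)
    also have "\<dots> = x b - x a" using assms that by (simp add: sum_subtractf)
    finally show ?thesis .
  qed
  moreover have "(-1 \<le> x b - x a \<and> x b - x a \<le> 1) = (\<bar>x a - x b\<bar> \<le> 1)" for a b
    by (auto simp: abs_le_iff)
  ultimately show ?thesis unfolding incidence_bounded_def by auto
qed

end

section \<open>The blocks around a fixed edge\<close>

locale graph_edge = locally_finite_graph G for G :: "'a pair_pre_digraph" +
  fixes u v :: 'a
  assumes edge: "(u, v) \<in> parcs G"
begin

lemma edge': "(v, u) \<in> parcs G"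
  using edge by (rule adj_sym)

abbreviation "Tri \<equiv> triangles G u v"
abbreviation "Squ \<equiv> square G u v"
abbreviation "Sqv \<equiv> square G v u"
abbreviation "Peu \<equiv> pent G u v"
abbreviation "Pev \<equiv> pent G v u"
abbreviation "Mid \<equiv> pent_mid G u v"
abbreviation "Fru \<equiv> free G u v"
abbreviation "Frv \<equiv> free G v u"

lemmas block_iff = triangles_iff square_iff[OF edge] square_iff[OF edge']
  pent_iff[OF edge] pent_iff[OF edge'] pent_mid_iff[OF edge] free_iff[OF edge] free_iff[OF edge']

lemma blocks_disjoint:
  "Tri \<inter> Squ = {}" "Tri \<inter> Sqv = {}" "Tri \<inter> Peu = {}" "Tri \<inter> Pev = {}" "Tri \<inter> Mid = {}"
  "Squ \<inter> Sqv = {}" "Squ \<inter> Peu = {}" "Squ \<inter> Pev = {}" "Squ \<inter> Mid = {}"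
  "Sqv \<inter> Peu = {}" "Sqv \<inter> Pev = {}" "Sqv \<inter> Mid = {}"
  "Peu \<inter> Pev = {}" "Peu \<inter> Mid = {}" "Pev \<inter> Mid = {}"
  by (auto simp: block_iff)

lemma free_disjoint:
  "Fru \<inter> Tri = {}" "Fru \<inter> Squ = {}" "Fru \<inter> Sqv = {}" "Fru \<inter> Peu = {}" "Fru \<inter> Pev = {}"
  "Frv \<inter> Tri = {}" "Frv \<inter> Squ = {}" "Frv \<inter> Sqv = {}" "Frv \<inter> Peu = {}" "Frv \<inter> Pev = {}"
  "Fru \<inter> Frv = {}"
  by (auto simp: block_iff) metis+

lemma endpoints_not_in_blocks:
  "u \<notin> Tri" "u \<notin> Squ" "u \<notin> Sqv" "u \<notin> Peu" "u \<notin> Pev" "u \<notin> Mid" "u \<notin> Fru" "u \<notin> Frv"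
  "v \<notin> Tri" "v \<notin> Squ" "v \<notin> Sqv" "v \<notin> Peu" "v \<notin> Pev" "v \<notin> Mid" "v \<notin> Fru" "v \<notin> Frv"
  by (auto simp: block_iff adj_irrefl)

lemma triangles_commute: "triangles G v u = Tri"
  by (auto simp: triangles_def)

lemma finite_core: "finite (core G u v)"
  by (simp add: core_def finite_blocks finite_pent_mid[OF edge])

section \<open>Decomposition into components\<close>

text \<open>Strong components require reachability both ways; the symmetry of the arcs supplies the
  way back. Hence no arc inside the core joins two components.\<close>

lemma core_components_reachable:
  assumes "R \<in> core_components G u v" "w \<in> R" "z \<in> core G u v" "(w, z) \<in> parcs G"
  shows "z \<in> R"
proof -
  interpret H: wf_digraph "with_proj G \<restriction> core G u v"
    by (rule wellformed_induce_subgraph)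
  have "w \<in> core G u v"
    using H.sccs_verts_subsets[of R] assms by (auto simp: core_components_def)
  with assms have "w \<rightarrow>\<^bsub>with_proj G \<restriction> core G u v\<^esub> z" "z \<rightarrow>\<^bsub>with_proj G \<restriction> core G u v\<^esub> w"
    by (force simp: arcs_ends_def arc_to_ends_def dest: adj_sym)+
  then have "w \<rightarrow>\<^sup>*\<^bsub>with_proj G \<restriction> core G u v\<^esub> z" "z \<rightarrow>\<^sup>*\<^bsub>with_proj G \<restriction> core G u v\<^esub> w"
    by (auto intro: H.reachable_adjI)
  with assms show ?thesis
    unfolding core_components_def H.in_sccs_verts_conv_reachable by blast
qed

lemma core_components_disjoint:
  assumes "R \<in> core_components G u v" "S \<in> core_components G u v" "w \<in> R" "w \<in> S"
  shows "R = S"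
proof -
  interpret H: wf_digraph "with_proj G \<restriction> core G u v"
    by (rule wellformed_induce_subgraph)
  show ?thesis
    using H.sccs_verts_disjoint assms unfolding core_components_def by blast
qed

lemma Union_core_components: "\<Union> (core_components G u v) = core G u v"
proof -
  interpret H: wf_digraph "with_proj G \<restriction> core G u v"
    by (rule wellformed_induce_subgraph)
  show ?thesis
    using H.sccs_verts_subsets H.scc_of_in_sccs_verts H.in_scc_of_self
    by (fastforce simp: core_components_def)
qed

lemma core_component_subset: "R \<in> core_components G u v \<Longrightarrow> R \<subseteq> core G u v"
  using Union_core_components by blast

lemma finite_core_components: "finite (core_components G u v)"
  using Union_core_components finite_core by (metis finite_UnionD)

text \<open>The set \<open>S\<close> lets one statement serve both programmes: triangles and squares
  for the first, \<open>UNIV\<close> for the second.\<close>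

lemma sum_core_components:
  fixes f :: "'a \<Rightarrow> real"
  shows "(\<Sum>R\<in>core_components G u v. \<Sum>w\<in>R \<inter> S. f w) = (\<Sum>w\<in>core G u v \<inter> S. f w)"
proof -
  have "(\<Sum>w\<in>(\<Union>R\<in>core_components G u v. R \<inter> S). f w)
      = (\<Sum>R\<in>core_components G u v. \<Sum>w\<in>R \<inter> S. f w)"
    by (rule sum.UNION_disjoint[OF finite_core_components])
      (auto dest: core_components_disjoint core_component_subset intro: finite_subset[OF _ finite_core])
  also have "(\<Union>R\<in>core_components G u v. R \<inter> S) = core G u v \<inter> S"
    using Union_core_components by blast
  finally show ?thesis by simp
qed

lemma glue_core_components:
  "\<exists>x. \<forall>R\<in>core_components G u v. \<forall>w\<in>R. x w = f R w"
proof (intro exI ballI)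
  fix R w assume "R \<in> core_components G u v" "w \<in> R"
  \<comment> \<open>The glued vector, found by unification, evaluates at \<open>w\<close> the vector
    of the unique component containing \<open>w\<close>.\<close>
  then have "(THE R. R \<in> core_components G u v \<and> w \<in> R) = R"
    using core_components_disjoint by (intro the_equality) auto
  then show "f (THE R. R \<in> core_components G u v \<and> w \<in> R) w = f R w" by simp
qed

text \<open>A programme whose constraints and objective both split over the components is solved by
  gluing optima. The two congruence hypotheses are needed because the glued vector agrees with
  \<open>f R\<close> only on \<open>R\<close>.\<close>

lemma is_arg_max_core_components:
  fixes obj :: "'a set \<Rightarrow> ('a \<Rightarrow> real) \<Rightarrow> real"
  assumes feas_cong: "\<And>R x y. (\<And>w. w \<in> R \<Longrightarrow> x w = y w) \<Longrightarrow> feas R x = feas R y"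
    and obj_cong: "\<And>R x y. (\<And>w. w \<in> R \<Longrightarrow> x w = y w) \<Longrightarrow> obj R x = obj R y"
    and feas_split: "\<And>x. feas (core G u v) x \<longleftrightarrow> (\<forall>R\<in>core_components G u v. feas R x)"
    and obj_split: "\<And>x. obj (core G u v) x = (\<Sum>R\<in>core_components G u v. obj R x)"
    and opt: "\<And>R. R \<in> core_components G u v \<Longrightarrow> is_arg_max (obj R) (feas R) (f R)"
  shows "\<exists>x. is_arg_max (obj (core G u v)) (feas (core G u v)) x \<and>
    obj (core G u v) x = (\<Sum>R\<in>core_components G u v. obj R (f R))"
proof -
  obtain x where x: "\<And>R w. R \<in> core_components G u v \<Longrightarrow> w \<in> R \<Longrightarrow> x w = f R w"
    using glue_core_components[of f] by blast
  have "feas R x" "obj R x = obj R (f R)" if "R \<in> core_components G u v" for R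
    using feas_cong[OF x[OF that]] obj_cong[OF x[OF that]] opt[OF that]
    by (auto simp: is_arg_max_def)
  then have "feas (core G u v) x"
    "obj (core G u v) x = (\<Sum>R\<in>core_components G u v. obj R (f R))"
    by (auto simp: feas_split obj_split)
  moreover have "obj (core G u v) y \<le> (\<Sum>R\<in>core_components G u v. obj R (f R))"
    if "feas (core G u v) y" for y
    unfolding obj_split
  proof (rule sum_mono)
    fix R assume R: "R \<in> core_components G u v"
    with that have "feas R y" by (simp add: feas_split)
    with opt[OF R] show "obj R y \<le> obj R (f R)" by (force simp: is_arg_max_def)
  qed
  ultimately show ?thesis
    by (intro exI[of _ x]) (auto simp: is_arg_max_def not_less)
qed

text \<open>From right to left, both ends of an arc of the core lie in the same component, so the
  constraint belongs to that component's programme.\<close>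

lemma incidence_bounded_core_components:
  "incidence_bounded G (core G u v \<inter> S) x \<longleftrightarrow>
    (\<forall>R\<in>core_components G u v. incidence_bounded G (R \<inter> S) x)"
    (is "?L \<longleftrightarrow> ?R")
proof
  assume ?L
  then have *: "\<bar>x a - x b\<bar> \<le> 1"
    if "a \<in> core G u v \<inter> S" "b \<in> core G u v \<inter> S" "(a, b) \<in> parcs G" for a b
    using that by (simp add: incidence_bounded_iff finite_core)
  show ?R
  proof
    fix R assume R: "R \<in> core_components G u v"
    then have "finite R" by (meson core_component_subset finite_core finite_subset)
    moreover have "\<bar>x a - x b\<bar> \<le> 1" if "a \<in> R \<inter> S" "b \<in> R \<inter> S" "(a, b) \<in> parcs G" for a b
      using *[of a b] that core_component_subset[OF R] by blast
    ultimately show "incidence_bounded G (R \<inter> S) x"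
      by (simp add: incidence_bounded_iff)
  qed
next
  assume R: ?R
  have "\<bar>x a - x b\<bar> \<le> 1"
    if ab: "a \<in> core G u v \<inter> S" "b \<in> core G u v \<inter> S" "(a, b) \<in> parcs G" for a b
  proof -
    from ab obtain R where Ra: "R \<in> core_components G u v" "a \<in> R"
      using Union_core_components by blast
    with ab have "b \<in> R" using core_components_reachable[of R a b] by blast
    moreover have "finite R" using Ra by (meson core_component_subset finite_core finite_subset)
    ultimately show ?thesis using R Ra ab by (auto simp: incidence_bounded_iff)
  qed
  then show ?L by (simp add: incidence_bounded_iff finite_core)
qed

lemma bounded_on_core_components:
  "bounded_on (core G u v \<inter> S) l h x \<longleftrightarrow>
    (\<forall>R\<in>core_components G u v. bounded_on (R \<inter> S) l h x)"
  unfolding bounded_on_def using Union_core_components by blast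

lemma index0_eq: "index0 G u v R = R \<inter> (Tri \<union> Squ \<union> Sqv)"
  by (auto simp: index0_def)

lemma optimal0_core:
  assumes "\<And>R. R \<in> core_components G u v \<Longrightarrow> optimal0 G u v R (f R)"
  shows "\<exists>x. optimal0 G u v (core G u v) x \<and>
    objective0 G u v (core G u v) x = (\<Sum>R\<in>core_components G u v. objective0 G u v R (f R))"
  unfolding optimal0_def
proof (rule is_arg_max_core_components)
  fix R and x y :: "'a \<Rightarrow> real" assume "\<And>w. w \<in> R \<Longrightarrow> x w = y w"
  then show "feasible0 G u v R x = feasible0 G u v R y"
    and "objective0 G u v R x = objective0 G u v R y"
    unfolding feasible0_def objective0_def index0_eq bounded_on_def incidence_bounded_def
    by auto
next
  fix x show "feasible0 G u v (core G u v) x = (\<forall>R\<in>core_components G u v. feasible0 G u v R x)"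
    unfolding feasible0_def index0_eq bounded_on_core_components incidence_bounded_core_components
    by blast
next
  fix x show "objective0 G u v (core G u v) x = (\<Sum>R\<in>core_components G u v. objective0 G u v R x)"
    unfolding objective0_def index0_eq sum_core_components ..
qed (use assms in \<open>simp add: optimal0_def\<close>)

lemma optimal_minus_core:
  assumes "\<And>R. R \<in> core_components G u v \<Longrightarrow> optimal_minus G u v R (f R)"
  shows "\<exists>x. optimal_minus G u v (core G u v) x \<and>
    objective_minus G u v (core G u v) x = (\<Sum>R\<in>core_components G u v. objective_minus G u v R (f R))"
  unfolding optimal_minus_def
proof (rule is_arg_max_core_components)
  fix R and x y :: "'a \<Rightarrow> real" assume "\<And>w. w \<in> R \<Longrightarrow> x w = y w"
  then show "feasible_minus G u v R x = feasible_minus G u v R y"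
    and "objective_minus G u v R x = objective_minus G u v R y"
    unfolding feasible_minus_def objective_minus_def bounded_on_def incidence_bounded_def
    by auto
next
  fix x
  show "feasible_minus G u v (core G u v) x = (\<forall>R\<in>core_components G u v. feasible_minus G u v R x)"
    unfolding feasible_minus_def bounded_on_core_components
    using incidence_bounded_core_components[where S = UNIV and x = x] by auto
next
  fix x
  show "objective_minus G u v (core G u v) x
      = (\<Sum>R\<in>core_components G u v. objective_minus G u v R x)"
    unfolding objective_minus_def
    using sum_core_components[where S = UNIV and f = "\<lambda>w. cost_minus G u v w * x w"] by simp
qed (use assms in \<open>simp add: optimal_minus_def\<close>)

section \<open>The two programmes on the whole core, written out by blocks\<close>

lemma feasible0_core_iff:
  "feasible0 G u v (core G u v) x \<longleftrightarrow>
    (\<forall>w\<in>Tri. -1 \<le> x w \<and> x w \<le> 1) \<and> (\<forall>w\<in>Squ. 0 \<le> x w \<and> x w \<le> 1) \<and>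
    (\<forall>w\<in>Sqv. -1 \<le> x w \<and> x w \<le> 0) \<and>
    (\<forall>a\<in>Tri \<union> Squ \<union> Sqv. \<forall>b\<in>Tri \<union> Squ \<union> Sqv. (a, b) \<in> parcs G \<longrightarrow> \<bar>x a - x b\<bar> \<le> 1)"
proof -
  have "core G u v \<inter> Tri = Tri" "core G u v \<inter> Squ = Squ" "core G u v \<inter> Sqv = Sqv"
    "core G u v \<inter> (Tri \<union> Squ \<union> Sqv) = Tri \<union> Squ \<union> Sqv"
    by (auto simp: core_def)
  then show ?thesis
    by (simp only: feasible0_def index0_eq bounded_on_def incidence_bounded_iff finite_blocks finite_Un)
qed

lemma feasible_minus_core_iff:
  "feasible_minus G u v (core G u v) x \<longleftrightarrow>
    (\<forall>w\<in>Tri. -1 \<le> x w \<and> x w \<le> 0) \<and> (\<forall>w\<in>Squ. -1 \<le> x w \<and> x w \<le> 1) \<and>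
    (\<forall>w\<in>Peu. 0 \<le> x w \<and> x w \<le> 1) \<and> (\<forall>w\<in>Sqv. -2 \<le> x w \<and> x w \<le> 0) \<and>
    (\<forall>w\<in>Pev. -2 \<le> x w \<and> x w \<le> -1) \<and>
    (\<forall>a\<in>core G u v. \<forall>b\<in>core G u v. (a, b) \<in> parcs G \<longrightarrow> \<bar>x a - x b\<bar> \<le> 1)"
proof -
  have "core G u v \<inter> Tri = Tri" "core G u v \<inter> Squ = Squ" "core G u v \<inter> Sqv = Sqv"
    "core G u v \<inter> Peu = Peu" "core G u v \<inter> Pev = Pev"
    by (auto simp: core_def)
  then show ?thesis
    by (simp only: feasible_minus_def bounded_on_def incidence_bounded_iff finite_core)
qed

lemma objective0_core:
  "objective0 G u v (core G u v) x =
    (mass G u - mass G v) * sum x Tri + mass G u * sum x Squ - mass G v * sum x Sqv"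
proof -
  have "core G u v \<inter> (Tri \<union> Squ \<union> Sqv) = Tri \<union> (Squ \<union> Sqv)"
    by (auto simp: core_def)
  then have "objective0 G u v (core G u v) x = (\<Sum>w\<in>Tri. cost0 G u v w * x w)
      + (\<Sum>w\<in>Squ. cost0 G u v w * x w) + (\<Sum>w\<in>Sqv. cost0 G u v w * x w)"
    unfolding objective0_def index0_eq
    by (simp add: sum.union_disjoint finite_blocks blocks_disjoint Int_Un_distrib)
  also have "(\<Sum>w\<in>Tri. cost0 G u v w * x w) = (mass G u - mass G v) * sum x Tri"
    by (simp add: sum_distrib_left cost0_def)
  also have "(\<Sum>w\<in>Squ. cost0 G u v w * x w) = mass G u * sum x Squ"
    unfolding sum_distrib_left
    by (intro sum.cong) (use blocks_disjoint in \<open>auto simp: cost0_def\<close>)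
  also have "(\<Sum>w\<in>Sqv. cost0 G u v w * x w) = - (mass G v * sum x Sqv)"
    unfolding sum_distrib_left sum_negf[symmetric]
    by (intro sum.cong) (use blocks_disjoint in \<open>auto simp: cost0_def\<close>)
  finally show ?thesis by simp
qed

lemma objective_minus_core:
  "objective_minus G u v (core G u v) x =
    (mass G u - mass G v) * sum x Tri + mass G u * sum x Squ + mass G u * sum x Peu
    - mass G v * sum x Sqv - mass G v * sum x Pev"
proof -
  have "core G u v = Tri \<union> (Squ \<union> (Peu \<union> (Sqv \<union> (Pev \<union> Mid))))"
    by (auto simp: core_def)
  then have "objective_minus G u v (core G u v) x = (\<Sum>w\<in>Tri. cost_minus G u v w * x w)
      + (\<Sum>w\<in>Squ. cost_minus G u v w * x w) + (\<Sum>w\<in>Peu. cost_minus G u v w * x w)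
      + (\<Sum>w\<in>Sqv. cost_minus G u v w * x w) + (\<Sum>w\<in>Pev. cost_minus G u v w * x w)
      + (\<Sum>w\<in>Mid. cost_minus G u v w * x w)"
    unfolding objective_minus_def
    by (simp add: sum.union_disjoint finite_blocks finite_pent_mid[OF edge] blocks_disjoint
        Int_Un_distrib Int_commute[of Peu Sqv])
  also have "(\<Sum>w\<in>Tri. cost_minus G u v w * x w) = (mass G u - mass G v) * sum x Tri"
    by (simp add: sum_distrib_left cost_minus_def)
  also have "(\<Sum>w\<in>Squ. cost_minus G u v w * x w) = mass G u * sum x Squ"
    unfolding sum_distrib_left
    by (intro sum.cong) (use blocks_disjoint in \<open>auto simp: cost_minus_def\<close>)
  also have "(\<Sum>w\<in>Peu. cost_minus G u v w * x w) = mass G u * sum x Peu"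
    unfolding sum_distrib_left
    by (intro sum.cong) (use blocks_disjoint in \<open>auto simp: cost_minus_def\<close>)
  also have "(\<Sum>w\<in>Sqv. cost_minus G u v w * x w) = - (mass G v * sum x Sqv)"
    unfolding sum_distrib_left sum_negf[symmetric]
    by (intro sum.cong) (use blocks_disjoint in \<open>auto simp: cost_minus_def\<close>)
  also have "(\<Sum>w\<in>Pev. cost_minus G u v w * x w) = - (mass G v * sum x Pev)"
    unfolding sum_distrib_left sum_negf[symmetric]
    by (intro sum.cong) (use blocks_disjoint in \<open>auto simp: cost_minus_def\<close>)
  also have "(\<Sum>w\<in>Mid. cost_minus G u v w * x w) = 0"
    by (intro sum.neutral) (use blocks_disjoint in \<open>auto simp: cost_minus_def\<close>)
  finally show ?thesis by simp
qed

section \<open>The transport functional and adjacency between blocks\<close>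

definition transport :: "('a \<Rightarrow> real) \<Rightarrow> real" where
  "transport x = mass G u * sum x (nbh G u) - mass G v * sum x (nbh G v)"

lemma transport_eq:
  "transport x =
    mass G u * (x v + sum x Tri + sum x Squ + sum x Peu + sum x Fru)
    - mass G v * (x u + sum x Tri + sum x Sqv + sum x Pev + sum x Frv)"
  unfolding transport_def sum_nbh[OF edge] sum_nbh[OF edge'] triangles_commute ..

lemma deg_pos_endpoints: "0 < deg G u" "0 < deg G v"
  using deg_pos[OF edge] deg_pos[OF edge'] by auto

lemma mass_nonneg: "0 \<le> mass G w"
  by (simp add: mass_def)

text \<open>Both averages have total weight 1, so a constant cancels. This permits the normalisation
  at \<open>u\<close>.\<close>

lemma transport_shift: "transport (\<lambda>w. x w + c) = transport x"
  using deg_pos_endpoints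
  by (simp add: transport_def sum.distrib mass_def deg_def field_simps)

lemma nbh_endpoints_cases:
  assumes "w \<in> nbh G u \<union> nbh G v"
  obtains "w = u" | "w = v" | "w \<in> Tri" | "w \<in> Squ" | "w \<in> Peu" | "w \<in> Fru"
    | "w \<in> Sqv" | "w \<in> Pev" | "w \<in> Frv"
  using assms by (auto simp: free_def nbh_def triangles_iff)

lemma block_adj:
  "w \<in> Tri \<Longrightarrow> (u, w) \<in> parcs G" "w \<in> Tri \<Longrightarrow> (v, w) \<in> parcs G"
  "w \<in> Squ \<Longrightarrow> (u, w) \<in> parcs G" "w \<in> Peu \<Longrightarrow> (u, w) \<in> parcs G" "w \<in> Fru \<Longrightarrow> (u, w) \<in> parcs G"
  "w \<in> Sqv \<Longrightarrow> (v, w) \<in> parcs G" "w \<in> Pev \<Longrightarrow> (v, w) \<in> parcs G" "w \<in> Frv \<Longrightarrow> (v, w) \<in> parcs G"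
  by (auto simp: block_iff)

lemma block_not_adj:
  "w \<in> Peu \<union> Fru \<Longrightarrow> z \<in> Tri \<union> Sqv \<union> Pev \<union> Frv \<Longrightarrow> (w, z) \<notin> parcs G"
  "w \<in> Peu \<union> Fru \<Longrightarrow> z \<in> Tri \<union> Sqv \<union> Pev \<union> Frv \<Longrightarrow> (z, w) \<notin> parcs G"
  "w \<in> Pev \<union> Frv \<Longrightarrow> z \<in> Tri \<union> Squ \<union> Peu \<union> Fru \<Longrightarrow> (w, z) \<notin> parcs G"
  "w \<in> Pev \<union> Frv \<Longrightarrow> z \<in> Tri \<union> Squ \<union> Peu \<union> Fru \<Longrightarrow> (z, w) \<notin> parcs G"
  using pent_free_not_adj[OF edge, of w z] pent_free_not_adj[OF edge', of w z]
    block_adj endpoints_not_in_blocks by blast+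

lemma free_not_adj_square:
  "w \<in> Fru \<Longrightarrow> z \<in> Squ \<Longrightarrow> (w, z) \<notin> parcs G" "w \<in> Fru \<Longrightarrow> z \<in> Squ \<Longrightarrow> (z, w) \<notin> parcs G"
  "w \<in> Frv \<Longrightarrow> z \<in> Sqv \<Longrightarrow> (w, z) \<notin> parcs G" "w \<in> Frv \<Longrightarrow> z \<in> Sqv \<Longrightarrow> (z, w) \<notin> parcs G"
  using free_square_not_adj[OF edge] free_square_not_adj[OF edge'] by blast+

lemma endpoint_not_adj:
  "z \<in> Squ \<union> Peu \<union> Fru \<Longrightarrow> (v, z) \<notin> parcs G" "z \<in> Squ \<union> Peu \<union> Fru \<Longrightarrow> (z, v) \<notin> parcs G"
  "z \<in> Sqv \<union> Pev \<union> Frv \<Longrightarrow> (u, z) \<notin> parcs G" "z \<in> Sqv \<union> Pev \<union> Frv \<Longrightarrow> (z, u) \<notin> parcs G"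
  by (auto simp: block_iff dest: adj_sym)

text \<open>The path u, t, c, s, v together with the edge closes a 5-cycle, so neither
  \<open>t\<close> nor \<open>s\<close> is free. The midpoint is a triangle or square vertex if it
  is adjacent to \<open>u\<close> or \<open>v\<close>, and otherwise has distance 2 from both. This
  is why \<open>Mid\<close> belongs to the core.\<close>

lemma common_nbh_in_core:
  assumes "t \<in> Squ \<union> Peu \<union> Fru" "s \<in> Sqv \<union> Pev \<union> Frv" "(t, c) \<in> parcs G" "(c, s) \<in> parcs G"
  shows "c \<in> core G u v" "t \<in> core G u v" "s \<in> core G u v"
proof -
  have t: "(u, t) \<in> parcs G" "t \<noteq> v" "(v, t) \<notin> parcs G"
    and s: "(v, s) \<in> parcs G" "s \<noteq> u" "(u, s) \<notin> parcs G"
    using assms(1,2) by (auto simp: block_iff)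
  have c: "c \<noteq> u" "c \<noteq> v" using assms(3,4) s t by (auto dest: adj_sym)
  have "t \<notin> Fru"
    using assms(3,4) s c unfolding free_iff[OF edge] by (meson adj_sym)
  then show "t \<in> core G u v" using assms(1) by (auto simp: core_def)
  have "s \<notin> Frv"
    using assms(3,4) t c unfolding free_iff[OF edge'] by (meson adj_sym)
  then show "s \<in> core G u v" using assms(2) by (auto simp: core_def)
  show "c \<in> core G u v"
  proof (cases "(u, c) \<in> parcs G")
    case True
    then have "c \<in> Tri \<union> Squ"
      using assms(4) s c by (auto simp: block_iff dest: adj_sym)
    then show ?thesis by (auto simp: core_def)
  next
    case False
    then have "c \<in> Sqv \<union> Mid"
      using assms(3,4) s t c by (auto simp: block_iff dest: adj_sym)
    then show ?thesis by (auto simp: core_def)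
  qed
qed

section \<open>Potentials attaining the three terms\<close>

lemma transport_attains_plus:
  "\<exists>y. lipschitz1 G y \<and>
    transport y = 1 - real (card Tri) / real (max (deg G u) (deg G v))"
proof -
  \<comment> \<open>Triangle values enter \<open>transport\<close> with coefficient m_u - m_v, which
    is positive exactly when d_u < d_v; \<open>c\<close> is the better end of [0, 1]. With all
    values in [0, 1] the Lipschitz condition is automatic.\<close>
  define c :: real where "c = (if deg G u < deg G v then 1 else 0)"
  define x where "x w = (if w \<in> Tri then c else if w \<in> nbh G u then 1 else 0)" for w
  have "0 \<le> x w \<and> x w \<le> 1" for w by (auto simp: x_def c_def)
  then have "\<bar>x a - x b\<bar> \<le> 1" for a b by (smt (verit))
  then have "lipschitz1 G x" by (simp add: lipschitz1_iff)
  moreover have "transport x = 1 - real (card Tri) / real (max (deg G u) (deg G v))"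
  proof -
    have Tri_u: "Tri \<subseteq> nbh G u" and Tri_v: "Tri \<subseteq> nbh G v" by (auto simp: triangles_def)
    have "sum x (nbh G u) = sum x Tri + sum x (nbh G u - Tri)"
      using sum.subset_diff[OF Tri_u finite_nbh, of x] by simp
    also have "sum x (nbh G u - Tri) = real (card (nbh G u - Tri))"
      by (simp add: x_def)
    also have "\<dots> = real (deg G u) - real (card Tri)"
      using card_mono[OF finite_nbh Tri_u] Tri_u
      by (simp add: card_Diff_subset finite_blocks deg_def of_nat_diff)
    finally have su: "sum x (nbh G u) = c * card Tri + (real (deg G u) - real (card Tri))"
      by (simp add: x_def)
    have "sum x (nbh G v) = sum x Tri + sum x (nbh G v - Tri)"
      using sum.subset_diff[OF Tri_v finite_nbh, of x] by simp
    also have "sum x (nbh G v - Tri) = 0"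
      by (intro sum.neutral) (auto simp: x_def triangles_def)
    finally have sv: "sum x (nbh G v) = c * card Tri"
      by (simp add: x_def)
    show ?thesis
      using deg_pos_endpoints unfolding transport_def su sv
      by (auto simp: c_def mass_def field_simps max_def)
  qed
  ultimately show ?thesis by blast
qed

text \<open>Free and pentagon neighbours of \<open>u\<close> and \<open>v\<close> get their extreme
  values 1 and -1. All prescribed values lie in [-1, 1], so pairs at distance 2 are harmless and
  only arcs have to be checked.\<close>

lemma transport_attains_zero:
  assumes "feasible0 G u v (core G u v) x"
  shows "\<exists>y. lipschitz1 G y \<and> transport y =
    (real (card Fru) + real (card Peu)) / real (deg G u)
    + (real (card Frv) + real (card Pev)) / real (deg G v) + objective0 G u v (core G u v) x"
proof -
  note f = assms[unfolded feasible0_core_iff]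
  define z where "z w = (if w \<in> {u, v} then 0 else if w \<in> Peu \<union> Fru then 1
    else if w \<in> Pev \<union> Frv then -1 else x w)" for w
  have z: "z u = 0" "z v = 0" "\<And>w. w \<in> Peu \<Longrightarrow> z w = 1" "\<And>w. w \<in> Fru \<Longrightarrow> z w = 1"
    "\<And>w. w \<in> Pev \<Longrightarrow> z w = -1" "\<And>w. w \<in> Frv \<Longrightarrow> z w = -1"
    "\<And>w. w \<in> Tri \<Longrightarrow> z w = x w" "\<And>w. w \<in> Squ \<Longrightarrow> z w = x w" "\<And>w. w \<in> Sqv \<Longrightarrow> z w = x w"
    using blocks_disjoint free_disjoint endpoints_not_in_blocks by (auto simp: z_def)
  have b: "(w \<in> Tri \<longrightarrow> -1 \<le> z w \<and> z w \<le> 1) \<and> (w \<in> Squ \<longrightarrow> 0 \<le> z w \<and> z w \<le> 1) \<and>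
    (w \<in> Sqv \<longrightarrow> -1 \<le> z w \<and> z w \<le> 0) \<and> (w \<in> Peu \<union> Fru \<longrightarrow> z w = 1) \<and>
    (w \<in> Pev \<union> Frv \<longrightarrow> z w = -1)" for w
    using f by (auto simp: z)
  have range: "-1 \<le> z s \<and> z s \<le> 1" if "s \<in> nbh G u \<union> nbh G v" for s
    using that by (cases rule: nbh_endpoints_cases) (use b[of s] z(1,2) in auto)
  have adj: "z t - z s \<le> 1"
    if s: "s \<in> nbh G u \<union> nbh G v" and t: "t \<in> nbh G u \<union> nbh G v" and st: "(s, t) \<in> parcs G" for s t
  proof -
    have c: "s \<in> Tri \<union> Squ \<union> Sqv \<and> t \<in> Tri \<union> Squ \<union> Sqv \<longrightarrow> z t - z s \<le> 1"
    proof
      assume *: "s \<in> Tri \<union> Squ \<union> Sqv \<and> t \<in> Tri \<union> Squ \<union> Sqv"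
      with f st have "\<bar>x s - x t\<bar> \<le> 1" by blast
      with * show "z t - z s \<le> 1" by (auto simp: z)
    qed
    \<comment> \<open>Value 1 on \<open>Peu\<close> and \<open>Fru\<close> could conflict only with
      negative values in \<open>Tri\<close>, \<open>Sqv\<close>, \<open>Pev\<close> or
      \<open>Frv\<close>, and no arc leads there. The sign bounds on the squares settle the arcs
      from \<open>Squ\<close> to the first two blocks, and symmetrically for
      \<open>v\<close>.\<close>
    from s t show ?thesis
      by (elim nbh_endpoints_cases)
        (use b[of s] b[of t] c st z(1,2) in \<open>simp_all add: block_not_adj\<close>)
  qed
  have "z t - z s \<le> 2" if "s \<in> nbh G u \<union> nbh G v" "t \<in> nbh G u \<union> nbh G v" for s t
    using range[OF that(1)] range[OF that(2)] by simp
  then obtain y where y: "lipschitz1 G y" "\<forall>s\<in>nbh G u \<union> nbh G v. y s = z s"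
    using lipschitz1_extension[of "nbh G u \<union> nbh G v" "-1" z] range adj by fastforce
  have "transport y = transport z"
    using y(2) by (simp add: transport_def)
  also have "\<dots> = mass G u * (sum x Tri + sum x Squ + card Peu + card Fru)
    - mass G v * (sum x Tri + sum x Sqv - card Pev - card Frv)"
    unfolding transport_eq by (simp add: z)
  also have "\<dots> = (real (card Fru) + real (card Peu)) / real (deg G u)
    + (real (card Frv) + real (card Pev)) / real (deg G v) + objective0 G u v (core G u v) x"
    unfolding objective0_core mass_def
    by (simp add: add_divide_distrib diff_divide_distrib algebra_simps)
  finally show ?thesis using y(1) by blast
qed

text \<open>Free neighbours of \<open>u\<close> and \<open>v\<close> get their extreme values 1 and
  -2. The range [-2, 1] has length exactly 3, so besides arcs the pairs at distance 2 need an
  argument; there the programme's constraints through a common neighbour come in.\<close>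

lemma transport_attains_minus:
  assumes "feasible_minus G u v (core G u v) x"
  shows "\<exists>y. lipschitz1 G y \<and> transport y =
    (real (card Fru) - 1) / real (deg G u) + 2 * real (card Frv) / real (deg G v)
    + objective_minus G u v (core G u v) x"
proof -
  note f = assms[unfolded feasible_minus_core_iff]
  define z where "z w = (if w = u then 0 else if w = v then -1 else if w \<in> Fru then 1
    else if w \<in> Frv then -2 else x w)" for w
  have z: "z u = 0" "z v = -1" "\<And>w. w \<in> Fru \<Longrightarrow> z w = 1" "\<And>w. w \<in> Frv \<Longrightarrow> z w = -2"
    "\<And>w. w \<in> Tri \<Longrightarrow> z w = x w" "\<And>w. w \<in> Squ \<Longrightarrow> z w = x w" "\<And>w. w \<in> Sqv \<Longrightarrow> z w = x w"
    "\<And>w. w \<in> Peu \<Longrightarrow> z w = x w" "\<And>w. w \<in> Pev \<Longrightarrow> z w = x w"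
    using blocks_disjoint free_disjoint endpoints_not_in_blocks edge adj_irrefl
    by (auto simp: z_def)
  have b: "(w \<in> Tri \<longrightarrow> -1 \<le> z w \<and> z w \<le> 0) \<and> (w \<in> Squ \<longrightarrow> -1 \<le> z w \<and> z w \<le> 1) \<and>
    (w \<in> Peu \<longrightarrow> 0 \<le> z w \<and> z w \<le> 1) \<and> (w \<in> Sqv \<longrightarrow> -2 \<le> z w \<and> z w \<le> 0) \<and>
    (w \<in> Pev \<longrightarrow> -2 \<le> z w \<and> z w \<le> -1) \<and>
    (w \<in> Fru \<longrightarrow> z w = 1) \<and> (w \<in> Frv \<longrightarrow> z w = -2)" for w
    using f by (auto simp: z)
  have range: "-2 \<le> z s \<and> z s \<le> 1" if "s \<in> nbh G u \<union> nbh G v" for s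
    using that by (cases rule: nbh_endpoints_cases) (use b[of s] z(1,2) in auto)
  have adj: "z t - z s \<le> 1"
    if s: "s \<in> nbh G u \<union> nbh G v" and t: "t \<in> nbh G u \<union> nbh G v" and st: "(s, t) \<in> parcs G" for s t
  proof -
    let ?C = "Tri \<union> Squ \<union> Peu \<union> Sqv \<union> Pev"
    have c: "s \<in> ?C \<and> t \<in> ?C \<longrightarrow> z t - z s \<le> 1"
    proof
      assume *: "s \<in> ?C \<and> t \<in> ?C"
      then have "s \<in> core G u v" "t \<in> core G u v" by (auto simp: core_def)
      with f st have "\<bar>x s - x t\<bar> \<le> 1" by blast
      with * show "z t - z s \<le> 1" by (auto simp: z)
    qed
    from s t show ?thesis
      by (elim nbh_endpoints_cases)
        (use b[of s] b[of t] c st z(1,2) in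
          \<open>simp_all add: block_not_adj free_not_adj_square endpoint_not_adj\<close>)
  qed
  have dist2: "z t - z s \<le> 2"
    if s: "s \<in> nbh G u \<union> nbh G v" and t: "t \<in> nbh G u \<union> nbh G v"
      and c: "(s, c) \<in> parcs G" "(c, t) \<in> parcs G" for s t c
  \<comment> \<open>A gap above 2 needs a positive value at \<open>t\<close> and one below -1 at
    \<open>s\<close>. These occur only among neighbours of \<open>u\<close> alone and of
    \<open>v\<close> alone, respectively.\<close>
  proof (cases "t \<in> Squ \<union> Peu \<union> Fru \<and> s \<in> Sqv \<union> Pev \<union> Frv")
    case True
    with c have "c \<in> core G u v" "t \<in> core G u v" "s \<in> core G u v"
      using common_nbh_in_core[of t s c] by (auto dest: adj_sym)
    \<comment> \<open>The midpoint lies in the core, so two arc constraints of the programme chain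
      to a gap of at most 2. Values on \<open>Mid\<close> enter only through such chains.\<close>
    with f c have "\<bar>x s - x c\<bar> \<le> 1" "\<bar>x c - x t\<bar> \<le> 1" by blast+
    moreover have "t \<notin> Fru" "s \<notin> Frv"
      using \<open>t \<in> core G u v\<close> \<open>s \<in> core G u v\<close> by (auto simp: core_def block_iff)
    ultimately show ?thesis using True z by auto
  next
    case False
    have "z t \<le> 0" if "t \<notin> Squ \<union> Peu \<union> Fru"
      using t by (cases rule: nbh_endpoints_cases) (use that b[of t] z(1,2) in auto)
    moreover have "-1 \<le> z s" if "s \<notin> Sqv \<union> Pev \<union> Frv"
      using s by (cases rule: nbh_endpoints_cases) (use that b[of s] z(1,2) in auto)
    ultimately show ?thesis using range[OF s] range[OF t] False by fastforce
  qed
  obtain y where y: "lipschitz1 G y" "\<forall>s\<in>nbh G u \<union> nbh G v. y s = z s"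
    using lipschitz1_extension[of "nbh G u \<union> nbh G v" "-2" z] range adj dist2 by fastforce
  have "transport y = transport z"
    using y(2) by (simp add: transport_def)
  also have "\<dots> = mass G u * (-1 + sum x Tri + sum x Squ + sum x Peu + card Fru)
    - mass G v * (sum x Tri + sum x Sqv + sum x Pev - 2 * card Frv)"
    unfolding transport_eq by (simp add: z)
  also have "\<dots> = (real (card Fru) - 1) / real (deg G u) + 2 * real (card Frv) / real (deg G v)
    + objective_minus G u v (core G u v) x"
    unfolding objective_minus_core mass_def
    by (simp add: add_divide_distrib diff_divide_distrib algebra_simps)
  finally show ?thesis using y(1) by blast
qed

section \<open>Upper bounds\<close>

lemma lipschitz1_adj:
  assumes "lipschitz1 G x" "(a, b) \<in> parcs G"
  shows "\<bar>x a - x b\<bar> \<le> 1"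
  using assms by (simp add: lipschitz1_iff)

text \<open>Values are at most 1 around \<open>u\<close> and at least 0 around \<open>v\<close>. The
  triangle sum \<open>T\<close> is shared by both averages and has coefficient m_u - m_v, whose sign
  decides which end of [0, \<open>card Tri\<close>] is extremal.\<close>

lemma transport_le_plus:
  assumes L: "lipschitz1 G x" and xu: "x u = 0" and xv: "x v = 1"
  shows "transport x \<le> 1 - real (card Tri) / real (max (deg G u) (deg G v))"
proof -
  have nu: "x w \<le> 1" if "(u, w) \<in> parcs G" for w
    using lipschitz1_adj[OF L that] xu by auto
  have nv: "0 \<le> x w" if "(v, w) \<in> parcs G" for w
    using lipschitz1_adj[OF L that] xv by auto
  define T where "T = sum x Tri"
  have T: "0 \<le> T" "T \<le> card Tri"
    using sum_bounded_above[of Tri x 1] nu nv block_adj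
    by (auto simp: T_def intro!: sum_nonneg)
  have Tri_u: "Tri \<subseteq> nbh G u" and Tri_v: "Tri \<subseteq> nbh G v" by (auto simp: triangles_def)
  have "sum x (nbh G u) = T + sum x (nbh G u - Tri)"
    using sum.subset_diff[OF Tri_u finite_nbh, of x] by (simp add: T_def)
  also have "sum x (nbh G u - Tri) \<le> real (card (nbh G u - Tri)) * 1"
    using nu by (intro sum_bounded_above) (auto simp: nbh_def)
  also have "real (card (nbh G u - Tri)) = real (deg G u) - real (card Tri)"
    using card_mono[OF finite_nbh Tri_u] Tri_u
    by (simp add: card_Diff_subset finite_blocks deg_def of_nat_diff)
  finally have su: "sum x (nbh G u) \<le> T + (real (deg G u) - real (card Tri))" by simp
  have "sum x (nbh G v) = T + sum x (nbh G v - Tri)"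
    using sum.subset_diff[OF Tri_v finite_nbh, of x] by (simp add: T_def)
  moreover have "0 \<le> sum x (nbh G v - Tri)"
    using nv by (intro sum_nonneg) (auto simp: nbh_def)
  ultimately have sv: "T \<le> sum x (nbh G v)" by simp
  have "transport x \<le> mass G u * (T + (real (deg G u) - real (card Tri))) - mass G v * T"
    unfolding transport_def
    using mult_left_mono[OF su mass_nonneg[of u]] mult_left_mono[OF sv mass_nonneg[of v]] by linarith
  also have "\<dots> = 1 - mass G u * card Tri + (mass G u - mass G v) * T"
    using deg_pos_endpoints by (simp add: mass_def algebra_simps diff_divide_distrib add_divide_distrib)
  also have "\<dots> \<le> 1 - real (card Tri) / real (max (deg G u) (deg G v))"
  proof (cases "deg G u < deg G v")
    case True
    then have "mass G v \<le> mass G u"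
      using deg_pos_endpoints by (simp add: mass_def frac_le)
    then have "(mass G u - mass G v) * T \<le> (mass G u - mass G v) * card Tri"
      using T by (intro mult_left_mono) auto
    then show ?thesis
      using True by (simp add: mass_def max_def algebra_simps)
  next
    case False
    then have "mass G u \<le> mass G v"
      using deg_pos_endpoints by (simp add: mass_def frac_le)
    then have "(mass G u - mass G v) * T \<le> 0"
      using T by (intro mult_nonpos_nonneg) auto
    then show ?thesis
      using False by (simp add: mass_def max_def)
  qed
  finally show ?thesis .
qed

lemma transport_le_zero:
  assumes L: "lipschitz1 G x" and xu: "x u = 0" and xv: "x v = 0"
  obtains y where "feasible0 G u v (core G u v) y"
    and "transport x \<le> (real (card Fru) + real (card Peu)) / real (deg G u)
    + (real (card Frv) + real (card Pev)) / real (deg G v) + objective0 G u v (core G u v) y"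
proof
  \<comment> \<open>Raising \<open>Squ\<close> to at least 0 and lowering \<open>Sqv\<close> to at
    most 0 can only increase \<open>transport\<close>, as the coefficients there are m_u and
    -m_v.\<close>
  define y where "y w = (if w \<in> Squ then max 0 (x w) else if w \<in> Sqv then min 0 (x w) else x w)" for w
  have y: "\<And>w. w \<in> Tri \<Longrightarrow> y w = x w" "\<And>w. w \<in> Squ \<Longrightarrow> y w = max 0 (x w)"
    "\<And>w. w \<in> Sqv \<Longrightarrow> y w = min 0 (x w)"
    using blocks_disjoint by (auto simp: y_def)
  have nu: "-1 \<le> x w \<and> x w \<le> 1" if "(u, w) \<in> parcs G" for w
    using lipschitz1_adj[OF L that] xu by auto
  have nv: "-1 \<le> x w \<and> x w \<le> 1" if "(v, w) \<in> parcs G" for w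
    using lipschitz1_adj[OF L that] xv by auto
  have n: "-1 \<le> x w \<and> x w \<le> 1" if "w \<in> Tri \<union> Squ \<union> Sqv" for w
    using that nu nv block_adj by blast
  \<comment> \<open>A clipped value is 0 and all values lie in [-1, 1], so clipping cannot break an
    arc constraint.\<close>
  have diff: "y a - y b \<le> 1"
    if "a \<in> Tri \<union> Squ \<union> Sqv" "b \<in> Tri \<union> Squ \<union> Sqv" "(a, b) \<in> parcs G" for a b
    using that(1,2) n[OF that(1)] n[OF that(2)] lipschitz1_adj[OF L that(3)]
    by (elim UnE) (auto simp: y max_def min_def abs_le_iff)
  have "\<bar>y a - y b\<bar> \<le> 1"
    if "a \<in> Tri \<union> Squ \<union> Sqv" "b \<in> Tri \<union> Squ \<union> Sqv" "(a, b) \<in> parcs G" for a b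
    using diff[OF that] diff[OF that(2,1) adj_sym[OF that(3)]] by linarith
  then show "feasible0 G u v (core G u v) y"
    unfolding feasible0_core_iff using n by (auto simp: y)
  have "sum x Squ \<le> sum y Squ" "sum y Sqv \<le> sum x Sqv" "sum x Tri = sum y Tri"
    by (auto intro!: sum_mono sum.cong simp: y)
  moreover have "sum x Peu \<le> real (card Peu)" "sum x Fru \<le> real (card Fru)"
    "- real (card Pev) \<le> sum x Pev" "- real (card Frv) \<le> sum x Frv"
    using sum_bounded_above[of Peu x 1] sum_bounded_above[of Fru x 1]
      sum_bounded_below[of Pev "-1" x] sum_bounded_below[of Frv "-1" x] nu nv block_adj
    by auto
  ultimately have
    "x v + sum x Tri + sum x Squ + sum x Peu + sum x Fru
      \<le> sum y Tri + sum y Squ + card Peu + card Fru"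
    "sum y Tri + sum y Sqv - card Pev - card Frv
      \<le> x u + sum x Tri + sum x Sqv + sum x Pev + sum x Frv"
    using xu xv by linarith+
  then have "transport x \<le> mass G u * (sum y Tri + sum y Squ + card Peu + card Fru)
    - mass G v * (sum y Tri + sum y Sqv - card Pev - card Frv)"
    unfolding transport_eq by (intro diff_mono mult_left_mono mass_nonneg)
  also have "\<dots> = (real (card Fru) + real (card Peu)) / real (deg G u)
    + (real (card Frv) + real (card Pev)) / real (deg G v) + objective0 G u v (core G u v) y"
    unfolding objective0_core mass_def
    by (simp add: add_divide_distrib diff_divide_distrib algebra_simps)
  finally show "transport x \<le> (real (card Fru) + real (card Peu)) / real (deg G u)
    + (real (card Frv) + real (card Pev)) / real (deg G v) + objective0 G u v (core G u v) y" .
qed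

lemma transport_le_minus:
  assumes L: "lipschitz1 G x" and xu: "x u = 0" and xv: "x v = -1"
  obtains y where "feasible_minus G u v (core G u v) y"
    and "transport x \<le> (real (card Fru) - 1) / real (deg G u) + 2 * real (card Frv) / real (deg G v)
    + objective_minus G u v (core G u v) y"
proof
  \<comment> \<open>The clipping of \<open>Peu\<close> and \<open>Pev\<close> enforces the bounds
    without decreasing \<open>transport\<close>. \<open>Mid\<close> must follow: a value -2 there
    next to a \<open>Peu\<close> value -1 would be at gap 2 once the latter is raised to 0.
    \<open>Mid\<close> does not occur in the objective, so its clipping is free of cost.\<close>
  define y where "y w = (if w \<in> Peu then max 0 (x w) else if w \<in> Pev then min (-1) (x w)
    else if w \<in> Mid then max (-1) (min 0 (x w)) else x w)" for w
  have y: "\<And>w. w \<in> Tri \<Longrightarrow> y w = x w" "\<And>w. w \<in> Squ \<Longrightarrow> y w = x w" "\<And>w. w \<in> Sqv \<Longrightarrow> y w = x w"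
    "\<And>w. w \<in> Peu \<Longrightarrow> y w = max 0 (x w)" "\<And>w. w \<in> Pev \<Longrightarrow> y w = min (-1) (x w)"
    "\<And>w. w \<in> Mid \<Longrightarrow> y w = max (-1) (min 0 (x w))"
    using blocks_disjoint by (auto simp: y_def)
  have nu: "-1 \<le> x w \<and> x w \<le> 1" if "(u, w) \<in> parcs G" for w
    using lipschitz1_adj[OF L that] xu by auto
  have nv: "-2 \<le> x w \<and> x w \<le> 0" if "(v, w) \<in> parcs G" for w
    using lipschitz1_adj[OF L that] xv by auto
  have n: "(w \<in> Tri \<longrightarrow> -1 \<le> x w \<and> x w \<le> 0) \<and> (w \<in> Squ \<union> Peu \<longrightarrow> -1 \<le> x w \<and> x w \<le> 1) \<and>
    (w \<in> Sqv \<union> Pev \<longrightarrow> -2 \<le> x w \<and> x w \<le> 0)" for w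
    using nu[of w] nv[of w] block_adj by blast
  \<comment> \<open>A clipped \<open>Peu\<close> value is 0 and its core neighbours lie in
    \<open>Peu\<close>, \<open>Squ\<close> or \<open>Mid\<close>, with values in [-1, 1]; likewise
    for -1 and [-2, 0] at \<open>Pev\<close>. Clipping \<open>Mid\<close> to [-1, 0] keeps its other
    arcs within 1.\<close>
  have diff: "y a - y b \<le> 1"
    if "a \<in> core G u v" "b \<in> core G u v" and ab: "(a, b) \<in> parcs G" for a b
    using that(1,2) unfolding core_def
    by (elim UnE)
      (use n[of a] n[of b] ab lipschitz1_adj[OF L ab] in
        \<open>auto simp: y block_not_adj max_def min_def abs_le_iff\<close>)
  have "\<bar>y a - y b\<bar> \<le> 1"
    if "a \<in> core G u v" "b \<in> core G u v" "(a, b) \<in> parcs G" for a b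
    using diff[OF that] diff[OF that(2,1) adj_sym[OF that(3)]] by linarith
  then show "feasible_minus G u v (core G u v) y"
    unfolding feasible_minus_core_iff using n by (auto simp: y)
  have "sum x Peu \<le> sum y Peu" "sum y Pev \<le> sum x Pev"
    "sum x Tri = sum y Tri" "sum x Squ = sum y Squ" "sum x Sqv = sum y Sqv"
    by (auto intro!: sum_mono sum.cong simp: y)
  moreover have "sum x Fru \<le> real (card Fru)" "- 2 * real (card Frv) \<le> sum x Frv"
    using sum_bounded_above[of Fru x 1] sum_bounded_below[of Frv "-2" x] nu nv block_adj
    by auto
  ultimately have
    "x v + sum x Tri + sum x Squ + sum x Peu + sum x Fru
      \<le> -1 + sum y Tri + sum y Squ + sum y Peu + card Fru"
    "sum y Tri + sum y Sqv + sum y Pev - 2 * card Frv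
      \<le> x u + sum x Tri + sum x Sqv + sum x Pev + sum x Frv"
    using xu xv by linarith+
  then have "transport x \<le> mass G u * (-1 + sum y Tri + sum y Squ + sum y Peu + card Fru)
    - mass G v * (sum y Tri + sum y Sqv + sum y Pev - 2 * card Frv)"
    unfolding transport_eq by (intro diff_mono mult_left_mono mass_nonneg)
  also have "\<dots> = (real (card Fru) - 1) / real (deg G u) + 2 * real (card Frv) / real (deg G v)
    + objective_minus G u v (core G u v) y"
    unfolding objective_minus_core mass_def
    by (simp add: add_divide_distrib diff_divide_distrib algebra_simps)
  finally show "transport x \<le> (real (card Fru) - 1) / real (deg G u)
    + 2 * real (card Frv) / real (deg G v) + objective_minus G u v (core G u v) y" .
qed

section \<open>Reduction to integer-valued potentials\<close>

lemma transport_sum: "transport (\<lambda>w. \<Sum>k\<in>K. x k w) = (\<Sum>k\<in>K. transport (x k))"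
  unfolding transport_def sum.swap[of _ K] by (simp add: sum_distrib_left sum_subtractf)

lemma transport_scale: "transport (\<lambda>w. c * x w) = c * transport x"
  by (simp add: transport_def algebra_simps flip: sum_distrib_left)

lemma transport_diff: "transport (\<lambda>w. x w - y w) = transport x - transport y"
  by (simp add: transport_def sum_subtractf algebra_simps)

text \<open>Each of the two averages is at most \<open>c\<close> in absolute value. This controls
  the rounding error below.\<close>

lemma transport_le_sup_norm:
  assumes "\<And>w. \<bar>x w\<bar> \<le> c"
  shows "transport x \<le> 2 * c"
proof -
  have "x w \<le> c" "- c \<le> x w" for w using assms[of w] by linarith+
  then have "sum x (nbh G u) \<le> deg G u * c" "deg G v * (-c) \<le> sum x (nbh G v)"
    unfolding deg_def by (blast intro: sum_bounded_above sum_bounded_below)+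
  then have "transport x \<le> mass G u * (deg G u * c) - mass G v * (deg G v * (-c))"
    unfolding transport_def by (intro diff_mono mult_left_mono mass_nonneg)
  also have "\<dots> = 2 * c"
    using deg_pos_endpoints by (simp add: mass_def)
  finally show ?thesis .
qed

text \<open>Averaging \<open>\<lfloor>x + k / n\<rfloor>\<close> over \<open>k < n\<close> recovers \<open>x\<close> up to \<open>1 / n\<close>, and
  rounding preserves the Lipschitz condition because distances are integers.\<close>

lemma transport_le_if_integer:
  assumes int: "\<And>z. lipschitz1 G z \<Longrightarrow> z u = 0 \<Longrightarrow> z v \<in> {-1, 0, 1} \<Longrightarrow> transport z \<le> M"
    and L: "lipschitz1 G x"
  shows "transport x \<le> M"
proof -
  define y where "y w = x w - x u" for w
  have Ly: "lipschitz1 G y" using L by (simp add: lipschitz1_iff y_def)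
  have "transport y = transport x"
    using transport_shift[of x "- x u"] by (simp add: y_def[abs_def])
  have step: "transport y \<le> M + 2 / real n" if n: "0 < n" for n :: nat
  proof -
    define z where "z k w = real_of_int \<lfloor>y w + real k / real n\<rfloor>" for k w
    have zM: "transport (z k) \<le> M" if k: "k < n" for k
    proof (rule int)
      have "\<bar>z k a - z k b\<bar> \<le> 1" if "(a, b) \<in> parcs G" for a b
      proof -
        have "\<bar>y a - y b\<bar> \<le> 1" using Ly that by (rule lipschitz1_adj)
        then have "\<lfloor>y a + real k / real n\<rfloor> \<le> \<lfloor>y b + real k / real n\<rfloor> + 1"
          "\<lfloor>y b + real k / real n\<rfloor> \<le> \<lfloor>y a + real k / real n\<rfloor> + 1"
          by linarith+
        then show ?thesis unfolding z_def by linarith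
      qed
      then show Lz: "lipschitz1 G (z k)" by (simp add: lipschitz1_iff)
      \<comment> \<open>Shifts smaller than 1 leave the value 0 at \<open>u\<close> unchanged, so
        the integer at \<open>v\<close> is -1, 0 or 1.\<close>
      have "\<lfloor>real k / real n\<rfloor> = 0" using k by (simp add: floor_eq_iff)
      then show zu: "z k u = 0" by (simp add: z_def y_def)
      have "\<bar>z k u - z k v\<bar> \<le> 1" using Lz edge by (rule lipschitz1_adj)
      then have "\<bar>\<lfloor>y v + real k / real n\<rfloor>\<bar> \<le> 1" using zu unfolding z_def by linarith
      then have "\<lfloor>y v + real k / real n\<rfloor> \<in> {-1, 0, 1}" by auto
      then show "z k v \<in> {-1, 0, 1}" by (auto simp: z_def)
    qed
    define a where "a w = (1 / real n) * (\<Sum>k<n. z k w)" for w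
    have "transport a = (1 / real n) * (\<Sum>k<n. transport (z k))"
      unfolding a_def transport_scale transport_sum ..
    also have "\<dots> \<le> (1 / real n) * (real n * M)"
      using sum_bounded_above[of "{..<n}" "\<lambda>k. transport (z k)" M] zM
      by (intro mult_left_mono) auto
    finally have "transport a \<le> M" using n by simp
    moreover have "\<bar>y w - a w\<bar> \<le> 1 / real n" for w
    proof -
      \<comment> \<open>By Hermite's identity the average is \<open>y w\<close> rounded down to a
        multiple of 1/n.\<close>
      have "a w = real_of_int \<lfloor>real n * y w\<rfloor> / real n"
        unfolding a_def z_def sum_floor_shifts[OF n, symmetric] by simp
      moreover have "real_of_int \<lfloor>real n * y w\<rfloor> \<le> real n * y w"
        "real n * y w \<le> real_of_int \<lfloor>real n * y w\<rfloor> + 1"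
        "real_of_int \<lfloor>real n * y w\<rfloor> \<le> 1 + real n * y w" by linarith+
      ultimately show ?thesis using n by (auto simp: abs_le_iff field_simps)
    qed
    then have "transport (\<lambda>w. y w - a w) \<le> 2 * (1 / real n)"
      by (rule transport_le_sup_norm)
    ultimately show ?thesis by (simp add: transport_diff)
  qed
  have "transport y \<le> M"
  proof (rule field_le_epsilon)
    fix e :: real assume "0 < e"
    then obtain n :: nat where "2 / e < real n" using reals_Archimedean2 by blast
    moreover have "0 < n" using calculation \<open>0 < e\<close> by (intro gr0I) (simp add: field_simps)
    ultimately have "2 / real n < e" using \<open>0 < e\<close> by (simp add: field_simps)
    with step[OF \<open>0 < n\<close>] show "transport y \<le> M + e" by linarith
  qed
  with \<open>transport y = transport x\<close> show ?thesis by simp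
qed

end

section \<open>The formula for the Wasserstein distance\<close>

theorem theorem9:
  fixes G :: "'a pair_pre_digraph" and u v :: 'a
    and x0 xm :: "'a set \<Rightarrow> 'a \<Rightarrow> real"
  assumes graph: "locally_finite_graph G"
    and edge: "(u, v) \<in> parcs G"
    and opt0: "\<And>R. R \<in> core_components G u v \<Longrightarrow> optimal0 G u v R (x0 R)"
    and optm: "\<And>R. R \<in> core_components G u v \<Longrightarrow> optimal_minus G u v R (xm R)"
  shows "wasserstein G u v =
    max (1 - real (card (triangles G u v)) / real (max (deg G u) (deg G v)))
   (max ((real (card (free G u v)) + real (card (pent G u v))) / real (deg G u)
         + (real (card (free G v u)) + real (card (pent G v u))) / real (deg G v)
         + (\<Sum>R\<in>core_components G u v. objective0 G u v R (x0 R)))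
        ((real (card (free G u v)) - 1) / real (deg G u)
         + 2 * real (card (free G v u)) / real (deg G v)
         + (\<Sum>R\<in>core_components G u v. objective_minus G u v R (xm R))))"
    (is "_ = max ?Tp (max (?F0 + ?S0) (?Fm + ?Sm))")
proof -
  interpret graph_edge G u v
    using graph edge by (simp add: graph_edge_def graph_edge_axioms_def)
  let ?M = "max ?Tp (max (?F0 + ?S0) (?Fm + ?Sm))"
  \<comment> \<open>The optima on the components glue to optima over the whole core, with the sums
    as their values.\<close>
  obtain X0 where X0: "optimal0 G u v (core G u v) X0" "objective0 G u v (core G u v) X0 = ?S0"
    using optimal0_core[of x0] opt0 by blast
  obtain Xm where Xm: "optimal_minus G u v (core G u v) Xm"
    "objective_minus G u v (core G u v) Xm = ?Sm"
    using optimal_minus_core[of xm] optm by blast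
  have le: "transport x \<le> ?M" if "lipschitz1 G x" for x
  proof (rule transport_le_if_integer[OF _ that])
    fix z assume z: "lipschitz1 G z" "z u = 0" "z v \<in> {-1, 0, 1}"
    then consider "z v = 1" | "z v = 0" | "z v = -1" by auto
    then show "transport z \<le> ?M"
    proof cases
      case 1
      show ?thesis using transport_le_plus[OF z(1,2) 1] by linarith
    next
      case 2
      obtain y where y: "feasible0 G u v (core G u v) y"
        "transport z \<le> ?F0 + objective0 G u v (core G u v) y"
        by (rule transport_le_zero[OF z(1,2) 2])
      from y(1) X0 have "objective0 G u v (core G u v) y \<le> ?S0"
        unfolding optimal0_def is_arg_max_def by (metis not_less)
      with y(2) show ?thesis by linarith
    next
      case 3
      obtain y where y: "feasible_minus G u v (core G u v) y"
        "transport z \<le> ?Fm + objective_minus G u v (core G u v) y"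
        by (rule transport_le_minus[OF z(1,2) 3])
      from y(1) Xm have "objective_minus G u v (core G u v) y \<le> ?Sm"
        unfolding optimal_minus_def is_arg_max_def by (metis not_less)
      with y(2) show ?thesis by linarith
    qed
  qed
  have "\<exists>y. lipschitz1 G y \<and> transport y = ?F0 + ?S0"
    using transport_attains_zero[of X0] X0 by (simp add: optimal0_def is_arg_max_def)
  moreover have "\<exists>y. lipschitz1 G y \<and> transport y = ?Fm + ?Sm"
    using transport_attains_minus[of Xm] Xm by (simp add: optimal_minus_def is_arg_max_def)
  moreover note transport_attains_plus
  \<comment> \<open>A maximum equals one of its arguments and each of the three is attained, so the
    bound \<open>?M\<close> is attained and the supremum is a maximum.\<close>
  ultimately have "\<exists>y. lipschitz1 G y \<and> transport y = ?M"
    unfolding max_def by presburger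
  then have "?M \<in> transport ` {x. lipschitz1 G x}" by (metis image_eqI mem_Collect_eq)
  then have "Sup (transport ` {x. lipschitz1 G x}) = ?M"
    using le by (intro cSup_eq_maximum) auto
  then show ?thesis
    unfolding wasserstein_def transport_def[abs_def] .
qed

end
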